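(* Let $\hat g\in C(\mathbb{R})$. Then the evolution operator $e^{tL}$ of the linear equation is well-defined from continuous initial data to the unique continuous solution: for every $u_{in}\in C(\mathbb{N}\times\mathbb{R})$ there is a unique weak solution $(t,l,\xi)\mapsto(e^{tL}u_{in})(l,\xi)$ in $C(\mathbb{R}^+\times\mathbb{N}\times\mathbb{R})$ with initial data $u_{in}$. For $u_{in}\in C(\mathbb{N}\times\mathbb{R})$ let $\nu(t)=(e^{tL}u_{in})(1,0)$. Then $\nu$ satisfies the Volterra equation $$\nu(t)+(k*\nu)(t)=u_{in}(1,t)\quad(t\in\mathbb{R}^+)$$ with the convolution kernel $k(t)=-\frac K2\hat g(t)$, and for all $t\in\mathbb{R}^+$, $\xi\in\mathbb{R}$ $$(e^{tL}u_{in})(1,\xi)=u_{in}(1,\xi+t)+\int_0^t\frac K2\,\nu(s)\,\hat g(\xi+t-s)\,ds,$$ and for $l\ge2$ $$(e^{tL}u_{in})(l,\xi)=u_{in}(l,\xi+tl).$$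
   Context: $\mathbb{R}^+=[0,\infty)$, $\mathbb{N}=\{1,2,\dots\}$, $K\ge0$ is a constant. The convolution is $(f*h)(t)=\int_0^tf(t-s)h(s)\,ds$ for $t\in\mathbb{R}^+$. The linear equation is $$\partial_tu(t,1,\xi)=\partial_\xi u(t,1,\xi)+\tfrac K2u(t,1,0)\hat g(\xi),\qquad \partial_tu(t,l,\xi)=l\,\partial_\xi u(t,l,\xi)\ \ (l\ge2).$$ A weak solution with initial data $u_{in}$ is a function $u\in C(\mathbb{R}^+\times\mathbb{N}\times\mathbb{R})$ such that for every compactly supported $h\in C^1(\mathbb{R}^+\times\mathbb{N}\times\mathbb{R})$ $$0=\sum_{l\in\mathbb{N}}\int_{\mathbb{R}}u_{in}(l,\xi)h(0,l,\xi)\,d\xi+\int_{\mathbb{R}^+}\int_{\mathbb{R}}\Big[\tfrac K2u(t,1,0)\hat g(\xi)h(t,1,\xi)+\sum_{l\in\mathbb{N}}u(t,l,\xi)\big(\partial_th(t,l,\xi)-l\,\partial_\xi h(t,l,\xi)\big)\Big]d\xi\,dt.$$ *)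

theory Defs
  imports "HOL-Analysis.Analysis"
begin

text \<open>Positive modes $l \in \{1,2,\dots\}$ are elements of the set \<open>{1..}\<close> of type nat, whose
  topology is discrete.\<close>

definition mode_dom :: "(nat \<times> real) set" where
  "mode_dom = {1..} \<times> UNIV"

definition spacetime_dom :: "(real \<times> nat \<times> real) set" where
  "spacetime_dom = {0..} \<times> {1..} \<times> UNIV"

text \<open>The time derivative is one-sided at $t = 0$.\<close>

definition partial_t :: "(real \<times> nat \<times> real \<Rightarrow> complex) \<Rightarrow> real \<times> nat \<times> real \<Rightarrow> complex" where
  "partial_t h = (\<lambda>(t, l, \<xi>). vector_derivative (\<lambda>\<tau>. h (\<tau>, l, \<xi>)) (at t within {0..}))"

definition partial_xi :: "(real \<times> nat \<times> real \<Rightarrow> complex) \<Rightarrow> real \<times> nat \<times> real \<Rightarrow> complex" where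
  "partial_xi h = (\<lambda>(t, l, \<xi>). vector_derivative (\<lambda>x. h (t, l, x)) (at \<xi>))"

definition C1_spacetime :: "(real \<times> nat \<times> real \<Rightarrow> complex) \<Rightarrow> bool" where
  "C1_spacetime h \<longleftrightarrow>
     continuous_on spacetime_dom h \<and>
     (\<forall>(t, l, \<xi>) \<in> spacetime_dom.
        (\<lambda>\<tau>. h (\<tau>, l, \<xi>)) differentiable (at t within {0..}) \<and>
        (\<lambda>x. h (t, l, x)) differentiable (at \<xi>)) \<and>
     continuous_on spacetime_dom (partial_t h) \<and>
     continuous_on spacetime_dom (partial_xi h)"

text \<open>The support is taken in the closed set \<^term>\<open>spacetime_dom\<close>, so a test function need not
  vanish at $t = 0$.\<close>

definition compactly_supported :: "(real \<times> nat \<times> real \<Rightarrow> complex) \<Rightarrow> bool" where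
  "compactly_supported h \<longleftrightarrow> compact (closure {p \<in> spacetime_dom. h p \<noteq> 0})"

text \<open>A weak solution is a function on \<^term>\<open>spacetime_dom\<close>; as HOL functions are total, it is
  represented by its extensional version, so that equality of weak solutions is equality on
  \<^term>\<open>spacetime_dom\<close>.\<close>

definition weak_solution ::
  "real \<Rightarrow> (real \<Rightarrow> complex) \<Rightarrow> (nat \<times> real \<Rightarrow> complex) \<Rightarrow> (real \<times> nat \<times> real \<Rightarrow> complex) \<Rightarrow> bool"
  where
  "weak_solution K ghat u_in u \<longleftrightarrow>
     u \<in> extensional spacetime_dom \<and>
     continuous_on spacetime_dom u \<and>
     (\<forall>h. C1_spacetime h \<and> compactly_supported h \<longrightarrow>
        0 = (\<Sum>\<^sub>\<infinity>l\<in>{1..}. (LBINT \<xi>. (u_in (l, \<xi>) * h (0, l, \<xi>))))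
          + (LBINT t:{0..}. (LBINT \<xi>.
              (complex_of_real (K / 2) * u (t, 1, 0) * ghat \<xi> * h (t, 1, \<xi>)
             + (\<Sum>\<^sub>\<infinity>l\<in>{1..}. u (t, l, \<xi>) *
                  (partial_t h (t, l, \<xi>) - of_nat l * partial_xi h (t, l, \<xi>)))))))"

definition evolution ::
  "real \<Rightarrow> (real \<Rightarrow> complex) \<Rightarrow> real \<Rightarrow> (nat \<times> real \<Rightarrow> complex) \<Rightarrow> nat \<times> real \<Rightarrow> complex" where
  "evolution K ghat t u_in = (\<lambda>(l, \<xi>). (THE u. weak_solution K ghat u_in u) (t, l, \<xi>))"

definition convolution :: "(real \<Rightarrow> complex) \<Rightarrow> (real \<Rightarrow> complex) \<Rightarrow> real \<Rightarrow> complex" where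
  "convolution f h t = (LBINT s:{0..t}. (f (t - s) * h s))"

end

theory Submission
  imports Defs
begin

text \<open>
  Every mode obeys a transport equation \<open>\<partial>\<^sub>t u = l \<partial>\<^sub>\<xi> u + F\<close> whose characteristics are the lines
  \<open>\<xi> + l t = const\<close>. Integrating along them turns the equation into Duhamel's formula, the mild
  form. For \<open>l \<ge> 2\<close> there is no source and the solution is a translate of the initial data. For
  \<open>l = 1\<close> the source contains the unknown only through its trace \<open>\<nu>(t) = u(t, 1, 0)\<close>, and
  Duhamel's formula at \<open>\<xi> = 0\<close> is a closed Volterra equation for \<open>\<nu>\<close>. So two facts suffice.

  \<^item> A Volterra equation with continuous kernel and data has exactly one continuous solution
  (\<open>volterra_exists\<close>, \<open>volterra_unique\<close>): the iterated operator is bounded by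
  \<open>(M T)^n / n!\<close> on \<open>[0, T]\<close>. The trace then determines the mild solution, and conversely
  provides one (\<open>mild_solution_unique\<close>, \<open>mild_solution_exists\<close>).

  \<^item> A continuous function is a weak solution if and only if it is a mild solution
  (\<open>weak_solution_iff_mild\<close>). This rests on an identity (\<open>weak_form_eq_defect\<close>) obtained
  by translating to characteristic coordinates, exchanging the integrals, and integrating by parts
  in time: the weak form tested with \<open>h\<close> equals the sum over \<open>l\<close> of the integrals
  \<open>\<integral> \<integral> D(t, l, x) (\<partial>\<^sub>t h - l \<partial>\<^sub>\<xi> h)(t, l, x - l t) dx dt\<close>, where \<open>D\<close> is the residual of
  Duhamel's formula. If \<open>D = 0\<close>, the weak form vanishes. If the weak form vanishes for all test
  functions, products \<open>A(t) \<beta>(x)\<close> in characteristic coordinates force \<open>D = 0\<close>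
  (\<open>mild_of_weak_form_zero\<close>). Test functions need not vanish at \<open>t = 0\<close>, so \<open>D = 0\<close>
  holds there too, which recovers the initial condition.
\<close>

section \<open>Integrals with a variable upper limit\<close>

text \<open>Rescaling the integration variable moves the dependence on the upper limit into the integrand, so
  that continuity in the limit becomes an instance of continuity of a parameter integral over a
  fixed interval.\<close>

lemma integral_rescale_unit:
  fixes f :: "real \<Rightarrow> complex"
  assumes "t \<ge> 0"
  shows "integral {0..t} f = of_real t * integral {0..1} (\<lambda>r. f (t * r))"
proof (cases "t = 0")
  case False
  with assms have t: "t > 0" by simp
  have "(\<lambda>x. x / t) ` {0..t} = {0..1}"
    using t by (simp add: image_divide_atLeastAtMost)
  with integral_stretch_real[of t 0 t f] t show ?thesis
    by (simp add: scaleR_conv_of_real)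
qed auto

lemma continuous_on_integral_upper_limit_param:
  fixes g :: "real \<Rightarrow> 'b::topological_space \<Rightarrow> complex"
  assumes "continuous_on ({0..} \<times> S) (\<lambda>(s, p). g s p)"
  shows "continuous_on ({0..} \<times> S) (\<lambda>(t, p). integral {0..t} (\<lambda>s. g s p))"
proof -
  have c: "continuous_on (({0..} \<times> S) \<times> cbox 0 (1::real)) (\<lambda>(q, r). g (fst q * r) (snd q))"
    unfolding case_prod_unfold
    by (rule continuous_on_compose2[OF assms, of _ "\<lambda>z. (fst (fst z) * snd z, snd (fst z))",
          unfolded case_prod_unfold fst_conv snd_conv])
      (auto intro!: continuous_intros)
  have "continuous_on ({0..} \<times> S)
      (\<lambda>q. of_real (fst q) * integral (cbox 0 1) (\<lambda>r. g (fst q * r) (snd q)))"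
    by (intro continuous_intros integral_continuous_on_param c)
  then show ?thesis
    by (rule continuous_on_eq)
      (clarsimp simp only: mem_Times_iff fst_conv snd_conv split_beta atLeast_iff cbox_interval,
        rule integral_rescale_unit[symmetric])
qed

lemma has_vector_derivative_integral_upper_limit:
  fixes f :: "real \<Rightarrow> complex"
  assumes "continuous_on {0..} f" "t \<ge> 0"
  shows "((\<lambda>t. integral {0..t} f) has_vector_derivative f t) (at t within {0..})"
proof -
  have "((\<lambda>t. integral {0..t} f) has_vector_derivative f t) (at t within {0..t+1})"
    using assms by (intro integral_has_vector_derivative) (auto intro: continuous_on_subset)
  moreover have "at t within {0..t+1} = at t within {0..}"
    by (rule at_within_nhd[of _ "{..<t+1}"]) auto
  ultimately show ?thesis by simp
qed

section \<open>Volterra equations with a continuous kernel\<close>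

text \<open>The Henstock-Kurzweil integral is used because the fundamental theorem of calculus and the exchange
  with uniform limits apply to it directly.\<close>

definition volterra :: "(real \<Rightarrow> complex) \<Rightarrow> (real \<Rightarrow> complex) \<Rightarrow> real \<Rightarrow> complex" where
  "volterra k f t = integral {0..t} (\<lambda>s. k (t - s) * f s)"

lemma continuous_on_volterra_integrand:
  fixes k :: "real \<Rightarrow> complex"
  assumes "continuous_on UNIV k" "continuous_on {0..} f" "t \<ge> 0"
  shows "continuous_on {0..t} (\<lambda>s. k (t - s) * f s)"
  using assms(2,3)
  by (intro continuous_intros continuous_on_compose2[OF assms(1)])
    (auto intro: continuous_on_subset)

lemma continuous_on_volterra:
  assumes k: "continuous_on UNIV k" and f: "continuous_on {0..} f"
  shows "continuous_on {0..} (volterra k f)"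
proof -
  have "continuous_on ({0..} \<times> UNIV) (\<lambda>(s, t). k (t - s) * f s)"
    unfolding case_prod_unfold
    by (intro continuous_intros continuous_on_compose2[OF k] continuous_on_compose2[OF f]) auto
  from continuous_on_integral_upper_limit_param[OF this]
  have "continuous_on {0..} (\<lambda>t. case (t, t) of (t, p) \<Rightarrow> integral {0..t} (\<lambda>s. k (p - s) * f s))"
    by (rule continuous_on_compose2) (auto intro!: continuous_intros)
  then show ?thesis by (simp add: volterra_def[abs_def])
qed

text \<open>Each application of the operator integrates the bound once more, which produces the factorial:
  \<open>n\<close> applications gain the factor \<open>(M T)^n / n!\<close>. This is what makes both uniqueness and the
  convergence of the Picard series work on arbitrarily long time intervals, for kernels of any size.\<close>

lemma volterra_factorial_bound:
  assumes k: "continuous_on UNIV k" and f: "continuous_on {0..} f"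
    and M: "\<And>s. s \<in> {0..T} \<Longrightarrow> norm (k s) \<le> M"
    and fb: "\<And>s. s \<in> {0..T} \<Longrightarrow> norm (f s) \<le> C * (M * s) ^ n / fact n"
    and t: "t \<in> {0..T}"
  shows "norm (volterra k f t) \<le> C * (M * t) ^ Suc n / fact (Suc n)"
proof -
  have M0: "M \<ge> 0" using M[OF t] norm_ge_zero order_trans by blast
  have "((\<lambda>s. C * (M * s) ^ Suc n / fact (Suc n)) has_real_derivative
          C * (of_nat (Suc n) * (M * s) ^ n * M) / fact (Suc n)) (at s within {0..t})" for s
    by (rule derivative_eq_intros refl | simp del: power_Suc of_nat_Suc)+
  moreover have "C * (of_nat (Suc n) * x * M) / fact (Suc n) = M * (C * x / fact n)" for x
  proof -
    have "C * (of_nat (Suc n) * x * M) / fact (Suc n) = (of_nat (Suc n) * (M * (C * x))) / (of_nat (Suc n) * fact n)"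
      by (simp only: fact_Suc mult_ac)
    also have "\<dots> = M * (C * x) / fact n"
      by (rule nonzero_mult_divide_mult_cancel_left) (simp del: of_nat_Suc)
    finally show ?thesis by simp
  qed
  ultimately have "((\<lambda>s. C * (M * s) ^ Suc n / fact (Suc n)) has_vector_derivative
          M * (C * (M * s) ^ n / fact n)) (at s within {0..t})" for s
    by (simp only: has_real_derivative_iff_has_vector_derivative)
  from fundamental_theorem_of_calculus[OF _ this] t
  have int: "((\<lambda>s. M * (C * (M * s) ^ n / fact n)) has_integral C * (M * t) ^ Suc n / fact (Suc n)) {0..t}"
    by simp
  have "norm (volterra k f t) \<le> integral {0..t} (\<lambda>s. M * (C * (M * s) ^ n / fact n))"
    unfolding volterra_def
  proof (rule integral_norm_bound_integral)
    show "(\<lambda>s. k (t - s) * f s) integrable_on {0..t}"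
      using continuous_on_volterra_integrand[OF k f] t by (intro integrable_continuous_interval) auto
    show "norm (k (t - s) * f s) \<le> M * (C * (M * s) ^ n / fact n)" if "s \<in> {0..t}" for s
      unfolding norm_mult using that t M0 by (intro mult_mono M fb) auto
  qed (use int in blast)
  then show ?thesis by (simp only: integral_unique[OF int])
qed

lemma continuous_on_interval_norm_bound:
  fixes f :: "real \<Rightarrow> complex"
  assumes "continuous_on {0..T} f"
  obtains C where "\<And>t. t \<in> {0..T} \<Longrightarrow> norm (f t) \<le> C"
proof -
  have "bounded (f ` {0..T})"
    using assms by (intro compact_imp_bounded compact_continuous_image) auto
  then show ?thesis using that unfolding bounded_iff by blast
qed

text \<open>The difference of two solutions is a fixed point of the operator, hence obeys the factorial bound
  for every \<open>n\<close>, and these bounds tend to zero.\<close>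

lemma volterra_unique:
  assumes k: "continuous_on UNIV k" and "continuous_on {0..} u" "continuous_on {0..} v"
    and u: "\<And>t. t \<ge> 0 \<Longrightarrow> u t = a t + volterra k u t"
    and v: "\<And>t. t \<ge> 0 \<Longrightarrow> v t = a t + volterra k v t"
    and "T \<ge> 0"
  shows "u T = v T"
proof -
  define d where "d = (\<lambda>t. u t - v t)"
  have d: "continuous_on {0..} d"
    unfolding d_def using assms by (intro continuous_intros)
  have eq: "d t = volterra k d t" if "t \<ge> 0" for t
  proof -
    have "volterra k d t = volterra k u t - volterra k v t"
      unfolding volterra_def d_def right_diff_distrib using assms that
      by (intro Henstock_Kurzweil_Integration.integral_diff integrable_continuous_interval
          continuous_on_volterra_integrand) auto
    with u[OF that] v[OF that] show ?thesis by (simp add: d_def)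
  qed
  obtain M where M: "\<And>s. s \<in> {0..T} \<Longrightarrow> norm (k s) \<le> M"
    using continuous_on_interval_norm_bound[OF continuous_on_subset[OF k]] by auto
  obtain C where C: "\<And>s. s \<in> {0..T} \<Longrightarrow> norm (d s) \<le> C"
    using continuous_on_interval_norm_bound[OF continuous_on_subset[OF d]] by auto
  have bound: "norm (d t) \<le> C * (M * t) ^ n / fact n" if "t \<in> {0..T}" for t n
    using that
  proof (induction n arbitrary: t)
    case (Suc n)
    from volterra_factorial_bound[OF k d M Suc.IH Suc.prems] eq Suc.prems show ?case by simp
  qed (use C in simp)
  have "(\<lambda>n. (M * T) ^ n / fact n) \<longlonglongrightarrow> 0"
    using summable_LIMSEQ_zero[OF summable_exp[of "M * T"]] by (simp add: field_simps)
  from tendsto_mult_left[OF this, of C] have "(\<lambda>n. C * (M * T) ^ n / fact n) \<longlonglongrightarrow> 0"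
    by simp
  with bound[of T] \<open>T \<ge> 0\<close> have "norm (d T) \<le> 0"
    by (intro LIMSEQ_le_const) auto
  then show ?thesis by (simp add: d_def)
qed

text \<open>The solution is the Neumann series \<open>a + k * a + k * (k * a) + \<dots>\<close>. By the factorial bound it
  converges uniformly on every bounded interval, so the limit is continuous and the operator may be
  applied term by term.\<close>

lemma volterra_exists:
  assumes k: "continuous_on UNIV k" and a: "continuous_on {0..} a"
  obtains u where "continuous_on {0..} u" "\<And>t. t \<ge> 0 \<Longrightarrow> u t = a t + volterra k u t"
proof -
  define N where "N n = (volterra k ^^ n) a" for n
  define S where "S m t = (\<Sum>n<m. N n t)" for m t
  define u where "u t = (\<Sum>n. N n t)" for t
  have N: "continuous_on {0..} (N n)" for n
    by (induction n) (auto simp: N_def a continuous_on_volterra[OF k])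
  have S: "continuous_on {0..} (S m)" for m
    unfolding S_def[abs_def] by (intro continuous_intros N)
  \<comment> \<open>The partial sums are exactly the Picard iterates.\<close>
  have rec: "S (Suc m) t = a t + volterra k (S m) t" if "t \<ge> 0" for m t
  proof -
    have "volterra k (S m) t = (\<Sum>n<m. volterra k (N n) t)"
      unfolding volterra_def S_def sum_distrib_left using that
      by (intro integral_sum integrable_continuous_interval continuous_on_volterra_integrand k N) auto
    then show ?thesis
      by (simp add: S_def sum.lessThan_Suc_shift N_def del: sum.lessThan_Suc)
  qed
  have lim: "uniform_limit {0..T} S u sequentially" if "T \<ge> 0" for T
  proof -
    obtain M where M: "\<And>s. s \<in> {0..T} \<Longrightarrow> norm (k s) \<le> M"
      using continuous_on_interval_norm_bound[OF continuous_on_subset[OF k]] by auto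
    obtain C where C: "\<And>s. s \<in> {0..T} \<Longrightarrow> norm (a s) \<le> C"
      using continuous_on_interval_norm_bound[OF continuous_on_subset[OF a]] by auto
    have M0: "M \<ge> 0" using that by (intro order_trans[OF norm_ge_zero M[of 0]]) auto
    have C0: "C \<ge> 0" using that by (intro order_trans[OF norm_ge_zero C[of 0]]) auto
    have bound: "norm (N n t) \<le> C * (M * t) ^ n / fact n" if "t \<in> {0..T}" for t n
      using that
    proof (induction n arbitrary: t)
      case (Suc n)
      from volterra_factorial_bound[OF k N M Suc.IH Suc.prems] show ?case by (simp add: N_def)
    qed (use C in \<open>simp add: N_def\<close>)
    have "norm (N n t) \<le> C * (M * T) ^ n / fact n" if t: "t \<in> {0..T}" for t n
    proof -
      have "C * (M * t) ^ n / fact n \<le> C * (M * T) ^ n / fact n"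
        using t M0 C0 by (intro divide_right_mono mult_left_mono power_mono) auto
      with bound[OF t] show ?thesis by (rule order_trans)
    qed
    moreover have "summable (\<lambda>n. C * (M * T) ^ n / fact n)"
      using summable_mult[OF summable_exp[of "M * T"], of C] by (simp add: field_simps)
    ultimately show ?thesis
      unfolding S_def[abs_def] u_def[abs_def] by (intro Weierstrass_m_test) auto
  qed
  have cont_T: "continuous_on {0..T} u" if "T \<ge> 0" for T
    using lim[OF that] by (rule uniform_limit_theorem[rotated])
      (auto intro!: always_eventually continuous_on_subset[OF S])
  have cont: "continuous_on {0..} u"
    unfolding continuous_on_eq_continuous_within
  proof
    fix t :: real assume t: "t \<in> {0..}"
    have "continuous (at t within {0..t+1}) u"
      using cont_T[of "t+1"] t by (simp add: continuous_on_eq_continuous_within)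
    moreover have "at t within {0..t+1} = at t within {0..}"
      by (rule at_within_nhd[of _ "{..<t+1}"]) auto
    ultimately show "continuous (at t within {0..}) u" by (simp add: continuous_within)
  qed
  have "u t = a t + volterra k u t" if t: "t \<ge> 0" for t
  proof -
    have kc: "continuous_on {0..t} (\<lambda>s. k (t - s))"
      by (intro continuous_on_compose2[OF k] continuous_intros) auto
    have "uniform_limit {0..t} (\<lambda>m s. k (t - s) * S m s) (\<lambda>s. k (t - s) * u s) sequentially"
      using kc cont_T[OF t]
      by (intro uniform_lim_mult lim t uniform_limit_const compact_imp_bounded compact_continuous_image) auto
    then obtain I J where IJ: "\<And>m. ((\<lambda>s. k (t - s) * S m s) has_integral I m) {0..t}"
      "((\<lambda>s. k (t - s) * u s) has_integral J) {0..t}" "I \<longlonglongrightarrow> J"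
      by (rule uniform_limit_integral)
        (auto intro!: continuous_on_volterra_integrand k S t)
    then have "I = (\<lambda>m. volterra k (S m) t)" "J = volterra k u t"
      by (auto simp: volterra_def fun_eq_iff intro!: integral_unique[symmetric])
    with IJ have "(\<lambda>m. volterra k (S m) t) \<longlonglongrightarrow> volterra k u t" by simp
    then have "(\<lambda>m. S (Suc m) t) \<longlonglongrightarrow> a t + volterra k u t"
      unfolding rec[OF t] by (intro tendsto_intros)
    moreover have "(\<lambda>m. S (Suc m) t) \<longlonglongrightarrow> u t"
      using tendsto_uniform_limitI[OF lim[OF t], of t] t
      by (subst filterlim_sequentially_Suc) auto
    ultimately show ?thesis using LIMSEQ_unique by blast
  qed
  with cont that show ?thesis by blast
qed

section \<open>Integrals of compactly supported functions\<close>

text \<open>The weak form is stated with Lebesgue integrals over unbounded sets. For compactly supported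
  integrands these lemmas turn them into integrals over intervals, where the fundamental theorem of
  calculus and the exchange of iterated integrals of continuous functions are available.\<close>

lemma
  fixes f :: "real \<Rightarrow> complex"
  assumes "continuous_on {a..b} f" "\<And>x. x \<notin> {a..b} \<Longrightarrow> f x = 0"
  shows integrable_of_support: "integrable lborel f"
    and LBINT_of_support: "(LBINT x. f x) = integral {a..b} f"
proof -
  have eq: "f = (\<lambda>x. indicator {a..b} x *\<^sub>R f x)"
    using assms(2) by (auto simp: indicator_def fun_eq_iff)
  have "set_integrable lborel {a..b} f"
    unfolding set_integrable_def using assms(1) by (intro borel_integrable_compact) auto
  then show "integrable lborel f" "(LBINT x. f x) = integral {a..b} f"
    using set_borel_integral_eq_integral(2)[of "{a..b}" f] eq
    by (simp_all add: set_integrable_def set_lebesgue_integral_def)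
qed

lemma set_LBINT_eq_integral:
  fixes f :: "real \<Rightarrow> complex"
  assumes "continuous_on {a..b} f"
  shows "(LBINT x:{a..b}. f x) = integral {a..b} f"
  using assms
  by (intro set_borel_integral_eq_integral) (auto simp: set_integrable_def intro: borel_integrable_compact)

lemma LBINT_shift:
  fixes f :: "real \<Rightarrow> complex"
  shows "(LBINT x. f x) = (LBINT x. f (x - d))"
  using lborel_integral_real_affine[of 1 f "-d"] by simp

section \<open>Transport along characteristics\<close>

text \<open>Along the curve \<open>\<xi> = x - c t\<close> the transport operator \<open>\<partial>\<^sub>t - c \<partial>\<^sub>\<xi>\<close> is an ordinary derivative in
  time. Only partial derivatives are given; continuity of the one in \<open>\<xi>\<close> upgrades them to a joint
  derivative, for which the chain rule holds, up to the boundary \<open>t = 0\<close>.\<close>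

lemma has_vector_derivative_along_characteristic:
  fixes \<eta> :: "real \<Rightarrow> real \<Rightarrow> complex"
  assumes dt: "\<And>t \<xi>. t \<ge> 0 \<Longrightarrow> ((\<lambda>\<tau>. \<eta> \<tau> \<xi>) has_vector_derivative \<eta>t t \<xi>) (at t within {0..})"
    and dx: "\<And>t \<xi>. t \<ge> 0 \<Longrightarrow> (\<eta> t has_vector_derivative \<eta>x t \<xi>) (at \<xi>)"
    and cx: "continuous_on ({0..} \<times> UNIV) (\<lambda>(t, \<xi>). \<eta>x t \<xi>)"
    and t: "t \<ge> 0"
  shows "((\<lambda>t. \<eta> t (x - c * t)) has_vector_derivative
           \<eta>t t (x - c * t) - of_real c * \<eta>x t (x - c * t)) (at t within {0..})"
proof -
  have 1: "((\<lambda>(t, \<xi>). \<eta> t \<xi>) has_derivative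
      (\<lambda>(dt, d\<xi>). dt *\<^sub>R \<eta>t t \<xi> + blinfun_scaleR_left (\<eta>x t \<xi>) d\<xi>))
      (at (t, \<xi>) within {0..} \<times> UNIV)" for \<xi>
  proof (rule has_derivative_partialsI)
    show "((\<lambda>t. \<eta> t \<xi>) has_derivative (\<lambda>dt. dt *\<^sub>R \<eta>t t \<xi>)) (at t within {0..})"
      using dt[OF t] by (simp add: has_vector_derivative_def)
    show "(\<eta> s has_derivative blinfun_scaleR_left (\<eta>x s y)) (at y within UNIV)" if "s \<in> {0..}" for s y
      using dx[of s y] that by (simp add: has_vector_derivative_def)
    have "continuous_on ({0..} \<times> UNIV) (\<lambda>(t, \<xi>). blinfun_scaleR_left (\<eta>x t \<xi>))"
      using cx unfolding case_prod_unfold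
      by (rule bounded_linear.continuous_on[OF bounded_linear_blinfun_scaleR_left])
    then show "continuous (at (t, \<xi>) within {0..} \<times> UNIV) (\<lambda>(t, \<xi>). blinfun_scaleR_left (\<eta>x t \<xi>))"
      using t by (simp add: continuous_on_eq_continuous_within)
  qed auto
  have 2: "((\<lambda>t. (t, x - c * t)) has_derivative (\<lambda>h. (h, - c * h))) (at t within {0..})"
    by (auto intro!: derivative_eq_intros)
  have "((\<lambda>t. case (t, x - c * t) of (t, \<xi>) \<Rightarrow> \<eta> t \<xi>) has_derivative
      (\<lambda>h. case (h, - c * h) of (dt, d\<xi>) \<Rightarrow>
        dt *\<^sub>R \<eta>t t (x - c * t) + blinfun_scaleR_left (\<eta>x t (x - c * t)) d\<xi>)) (at t within {0..})"
    by (rule has_derivative_in_compose[OF 2 has_derivative_subset[OF 1]]) auto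
  then show ?thesis
    by (simp add: has_vector_derivative_def scaleR_conv_of_real algebra_simps)
qed

lemma continuous_on_shift_characteristic:
  fixes g :: "real \<Rightarrow> real \<Rightarrow> complex"
  assumes "continuous_on ({0..} \<times> UNIV) (\<lambda>(t, \<xi>). g t \<xi>)"
  shows "continuous_on ({0..} \<times> UNIV) (\<lambda>(t, x). g t (x - c * t))"
proof -
  have "continuous_on ({0..} \<times> UNIV) (\<lambda>q. case (fst q, snd q - c * fst q) of (t, \<xi>) \<Rightarrow> g t \<xi>)"
    by (rule continuous_on_compose2[OF assms]) (auto intro!: continuous_intros)
  then show ?thesis by (simp add: case_prod_unfold)
qed

lemma continuous_on_time_slice:
  fixes g :: "real \<Rightarrow> real \<Rightarrow> complex"
  assumes "continuous_on ({0..} \<times> UNIV) (\<lambda>(t, \<xi>). g t \<xi>)" "t \<ge> 0"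
  shows "continuous_on S (g t)"
proof -
  have "continuous_on S (\<lambda>\<xi>. case (t, \<xi>) of (t, \<xi>) \<Rightarrow> g t \<xi>)"
    using assms(2) by (intro continuous_on_compose2[OF assms(1)]) (auto intro!: continuous_intros)
  then show ?thesis by simp
qed

lemma continuous_on_space_slice:
  fixes g :: "real \<Rightarrow> real \<Rightarrow> complex"
  assumes "continuous_on ({0..} \<times> UNIV) (\<lambda>(t, \<xi>). g t \<xi>)" "S \<subseteq> {0..}"
  shows "continuous_on S (\<lambda>t. g t \<xi>)"
proof -
  have "continuous_on S (\<lambda>t. case (t, \<xi>) of (t, \<xi>) \<Rightarrow> g t \<xi>)"
    using assms(2) by (intro continuous_on_compose2[OF assms(1)]) (auto intro!: continuous_intros)
  then show ?thesis by simp
qed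

lemma continuous_on_integral_space:
  fixes g :: "real \<Rightarrow> real \<Rightarrow> complex"
  assumes "continuous_on ({0..} \<times> UNIV) (\<lambda>(t, x). g t x)" "S \<subseteq> {0..}"
  shows "continuous_on S (\<lambda>t. integral {a..b} (g t))"
  using integral_continuous_on_param[of S a b g] continuous_on_subset[OF assms(1)] assms(2)
  by (simp add: subset_iff)

text \<open>The residual of Duhamel's formula on the characteristic through \<open>(0, x)\<close>, for speed \<open>c\<close>, initial
  data \<open>a\<close> and source \<open>f\<close>. It vanishes identically exactly when \<open>w\<close> is the mild solution of
  \<open>\<partial>\<^sub>t w = c \<partial>\<^sub>\<xi> w + f\<close> with data \<open>a\<close>.\<close>

definition transport_defect ::
  "real \<Rightarrow> (real \<Rightarrow> complex) \<Rightarrow> (real \<Rightarrow> real \<Rightarrow> complex) \<Rightarrow> (real \<Rightarrow> real \<Rightarrow> complex) \<Rightarrow>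
    real \<Rightarrow> real \<Rightarrow> complex"
  where "transport_defect c a f w t x =
    w t (x - c * t) - a x - integral {0..t} (\<lambda>s. f s (x - c * s))"

lemma continuous_on_transport_defect:
  assumes a: "continuous_on UNIV a"
    and f: "continuous_on ({0..} \<times> UNIV) (\<lambda>(t, \<xi>). f t \<xi>)"
    and w: "continuous_on ({0..} \<times> UNIV) (\<lambda>(t, \<xi>). w t \<xi>)"
  shows "continuous_on ({0..} \<times> UNIV) (\<lambda>(t, x). transport_defect c a f w t x)"
  using continuous_on_integral_upper_limit_param[OF continuous_on_shift_characteristic[OF f, of c]]
    continuous_on_shift_characteristic[OF w, of c]
  unfolding transport_defect_def case_prod_unfold
  by (intro continuous_intros continuous_on_compose2[OF a]) auto

text \<open>One mode of a test function: \<open>\<eta>t\<close> and \<open>\<eta>x\<close> are its partial derivatives. The support condition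
  includes \<open>t = T\<close>, so that no boundary term at the final time survives in integrations by parts,
  while \<open>\<eta>\<close> is unconstrained at \<open>t = 0\<close>.\<close>

locale test_profile =
  fixes \<eta> \<eta>t \<eta>x :: "real \<Rightarrow> real \<Rightarrow> complex" and T R :: real
  assumes T: "T \<ge> 0"
    and deriv_t: "t \<ge> 0 \<Longrightarrow> ((\<lambda>\<tau>. \<eta> \<tau> \<xi>) has_vector_derivative \<eta>t t \<xi>) (at t within {0..})"
    and deriv_x: "t \<ge> 0 \<Longrightarrow> (\<eta> t has_vector_derivative \<eta>x t \<xi>) (at \<xi>)"
    and cont: "continuous_on ({0..} \<times> UNIV) (\<lambda>(t, \<xi>). \<eta> t \<xi>)"
    and cont_t: "continuous_on ({0..} \<times> UNIV) (\<lambda>(t, \<xi>). \<eta>t t \<xi>)"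
    and cont_x: "continuous_on ({0..} \<times> UNIV) (\<lambda>(t, \<xi>). \<eta>x t \<xi>)"
    and support: "\<lbrakk>t \<ge> 0; T \<le> t \<or> R \<le> \<bar>\<xi>\<bar>\<rbrakk> \<Longrightarrow> \<eta> t \<xi> = 0 \<and> \<eta>t t \<xi> = 0 \<and> \<eta>x t \<xi> = 0"
begin

lemma continuous_on_transport_derivative:
  "continuous_on ({0..} \<times> UNIV) (\<lambda>(t, \<xi>). \<eta>t t \<xi> - of_real c * \<eta>x t \<xi>)"
  using cont_t cont_x unfolding case_prod_unfold by (intro continuous_intros)

text \<open>For each fixed time, passing to characteristic coordinates is a mere translation in \<open>\<xi>\<close>. The
  translated support stays in \<open>[-X, X]\<close> for all times up to \<open>T\<close>.\<close>

lemma
  assumes f: "continuous_on ({0..} \<times> UNIV) (\<lambda>(t, \<xi>). f t \<xi>)"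
    and w: "continuous_on ({0..} \<times> UNIV) (\<lambda>(t, \<xi>). w t \<xi>)"
    and t: "t \<in> {0..T}"
    and c: "c \<ge> 0" and X: "R + c * T \<le> X"
  shows integrable_weak_integrand:
    "integrable lborel (\<lambda>\<xi>. f t \<xi> * \<eta> t \<xi> + w t \<xi> * (\<eta>t t \<xi> - of_real c * \<eta>x t \<xi>))" (is ?int)
    and LBINT_weak_integrand:
    "(LBINT \<xi>. f t \<xi> * \<eta> t \<xi> + w t \<xi> * (\<eta>t t \<xi> - of_real c * \<eta>x t \<xi>)) =
     integral {-X..X} (\<lambda>x. f t (x - c * t) * \<eta> t (x - c * t) +
       w t (x - c * t) * (\<eta>t t (x - c * t) - of_real c * \<eta>x t (x - c * t)))" (is ?eq)
proof -
  define g where "g t \<xi> = f t \<xi> * \<eta> t \<xi> + w t \<xi> * (\<eta>t t \<xi> - of_real c * \<eta>x t \<xi>)" for t \<xi>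
  have g: "continuous_on ({0..} \<times> UNIV) (\<lambda>(t, \<xi>). g t \<xi>)"
    using f w cont cont_t cont_x
    unfolding g_def case_prod_unfold by (intro continuous_intros)
  have g0: "g t \<xi> = 0" if "R \<le> \<bar>\<xi>\<bar>" for \<xi>
    using support[of t \<xi>] t that by (simp add: g_def)
  show ?int
    using integrable_of_support[of "-R" R "g t"] continuous_on_time_slice[OF g, of t] t g0
    unfolding g_def[symmetric] by force
  have ct: "0 \<le> c * t" "c * t \<le> c * T" using c t by (auto intro: mult_left_mono)
  have "(LBINT \<xi>. g t \<xi>) = (LBINT x. g t (x - c * t))"
    by (rule LBINT_shift)
  also have "\<dots> = integral {-X..X} (\<lambda>x. g t (x - c * t))"
  proof (rule LBINT_of_support)
    show "continuous_on {-X..X} (\<lambda>x. g t (x - c * t))"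
      using t by (intro continuous_on_time_slice[OF continuous_on_shift_characteristic[OF g]]) auto
    show "g t (x - c * t) = 0" if "x \<notin> {-X..X}" for x
      using that X ct by (intro g0) auto
  qed
  finally show ?eq unfolding g_def .
qed

lemma continuous_on_LBINT_weak_integrand:
  assumes f: "continuous_on ({0..} \<times> UNIV) (\<lambda>(t, \<xi>). f t \<xi>)"
    and w: "continuous_on ({0..} \<times> UNIV) (\<lambda>(t, \<xi>). w t \<xi>)"
    and c: "c \<ge> 0"
  shows "continuous_on {0..T} (\<lambda>t. LBINT \<xi>.
    f t \<xi> * \<eta> t \<xi> + w t \<xi> * (\<eta>t t \<xi> - of_real c * \<eta>x t \<xi>))"
proof -
  have "continuous_on ({0..} \<times> UNIV)
      (\<lambda>(t, \<xi>). f t \<xi> * \<eta> t \<xi> + w t \<xi> * (\<eta>t t \<xi> - of_real c * \<eta>x t \<xi>))"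
    using f w cont cont_t cont_x unfolding case_prod_unfold by (intro continuous_intros)
  from continuous_on_shift_characteristic[OF this, of c]
  have "continuous_on {0..T} (\<lambda>t. integral {-(R + c * T)..R + c * T}
      (\<lambda>x. f t (x - c * t) * \<eta> t (x - c * t) +
        w t (x - c * t) * (\<eta>t t (x - c * t) - of_real c * \<eta>x t (x - c * t))))"
    by (rule continuous_on_integral_space) auto
  then show ?thesis
    by (rule continuous_on_eq) (rule LBINT_weak_integrand[OF f w _ c order_refl, symmetric])
qed

text \<open>The central identity: the weak form of a transport equation is the Duhamel residual tested against
  the time derivative of the test function along characteristics. Indeed, the Duhamel integral \<open>V\<close>
  satisfies \<open>\<partial>\<^sub>t V = F\<close> on each characteristic, so integration by parts shows that \<open>V\<close> makes the
  weak form vanish; subtracting its weak form from that of \<open>w\<close> leaves only the terms containing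
  \<open>w - V\<close>. It serves in both directions of the equivalence between weak and mild
  solutions.\<close>

lemma weak_form_eq_defect:
  assumes a: "continuous_on UNIV a"
    and f: "continuous_on ({0..} \<times> UNIV) (\<lambda>(t, \<xi>). f t \<xi>)"
    and w: "continuous_on ({0..} \<times> UNIV) (\<lambda>(t, \<xi>). w t \<xi>)"
    and c: "c \<ge> 0" and X: "R + c * T \<le> X"
  shows "(LBINT \<xi>. a \<xi> * \<eta> 0 \<xi>) + integral {0..T} (\<lambda>t. LBINT \<xi>.
           f t \<xi> * \<eta> t \<xi> + w t \<xi> * (\<eta>t t \<xi> - of_real c * \<eta>x t \<xi>)) =
         integral {0..T} (\<lambda>t. integral {-X..X} (\<lambda>x. transport_defect c a f w t x *
           (\<eta>t t (x - c * t) - of_real c * \<eta>x t (x - c * t))))"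
proof -
  define H where "H t x = \<eta> t (x - c * t)" for t x
  define H' where "H' t x = \<eta>t t (x - c * t) - of_real c * \<eta>x t (x - c * t)" for t x
  define F where "F t x = f t (x - c * t)" for t x
  define W where "W t x = w t (x - c * t)" for t x
  define V where "V t x = a x + integral {0..t} (\<lambda>s. F s x)" for t x
  have cH: "continuous_on ({0..} \<times> UNIV) (\<lambda>(t, x). H t x)"
    unfolding H_def by (rule continuous_on_shift_characteristic[OF cont])
  have cH': "continuous_on ({0..} \<times> UNIV) (\<lambda>(t, x). H' t x)"
    unfolding H'_def
    by (rule continuous_on_shift_characteristic[OF continuous_on_transport_derivative])
  have cF: "continuous_on ({0..} \<times> UNIV) (\<lambda>(t, x). F t x)"
    unfolding F_def by (rule continuous_on_shift_characteristic[OF f])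
  have cW: "continuous_on ({0..} \<times> UNIV) (\<lambda>(t, x). W t x)"
    unfolding W_def by (rule continuous_on_shift_characteristic[OF w])
  have cV: "continuous_on ({0..} \<times> UNIV) (\<lambda>(t, x). V t x)"
    using continuous_on_integral_upper_limit_param[OF cF] unfolding V_def case_prod_unfold
    by (intro continuous_intros continuous_on_compose2[OF a]) auto
  have cP: "continuous_on ({0..} \<times> UNIV) (\<lambda>(t, x). F t x * H t x + W t x * H' t x)"
    using cF cH cW cH' unfolding case_prod_unfold by (intro continuous_intros)
  have cQ: "continuous_on ({0..} \<times> UNIV) (\<lambda>(t, x). F t x * H t x + V t x * H' t x)"
    using cF cH cV cH' unfolding case_prod_unfold by (intro continuous_intros)
  have X0: "R \<le> X" using X c T by (smt (verit) mult_nonneg_nonneg)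

  \<comment> \<open>The product rule for V times H; the contribution of the final time vanishes with H T.\<close>
  have by_parts: "integral {0..T} (\<lambda>t. F t x * H t x + V t x * H' t x) = - (a x * \<eta> 0 x)" for x
  proof -
    have "((\<lambda>t. V t x * H t x) has_vector_derivative F t x * H t x + V t x * H' t x) (at t within {0..})"
      if t: "t \<ge> 0" for t
    proof -
      have V: "((\<lambda>t. V t x) has_vector_derivative F t x) (at t within {0..})"
        unfolding V_def using t
        by (auto intro!: derivative_eq_intros has_vector_derivative_integral_upper_limit
            continuous_on_space_slice[OF cF])
      have H: "((\<lambda>t. H t x) has_vector_derivative H' t x) (at t within {0..})"
        unfolding H_def H'_def
        by (rule has_vector_derivative_along_characteristic[OF deriv_t deriv_x cont_x t])
      show ?thesis
        using has_vector_derivative_mult[OF V H] by (simp add: add.commute)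
    qed
    note has_vector_derivative_within_subset[OF this, of _ "{0..T}"]
    then have "((\<lambda>t. F t x * H t x + V t x * H' t x) has_integral V T x * H T x - V 0 x * H 0 x) {0..T}"
      using T
      by (intro fundamental_theorem_of_calculus) auto
    moreover have "H T x = 0" using support[of T] T by (simp add: H_def)
    ultimately show ?thesis by (simp add: integral_unique V_def H_def)
  qed

  have "integral {0..T} (\<lambda>t. integral {-X..X} (\<lambda>x. F t x * H t x + V t x * H' t x)) =
      integral {-X..X} (\<lambda>x. integral {0..T} (\<lambda>t. F t x * H t x + V t x * H' t x))"
    using integral_swap_continuous[of 0 "-X" T X "\<lambda>t x. F t x * H t x + V t x * H' t x"]
      continuous_on_subset[OF cQ] by (simp add: cbox_Pair_eq subset_iff)
  also have "\<dots> = - integral {-X..X} (\<lambda>x. a x * \<eta> 0 x)"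
    unfolding by_parts by simp
  also have "integral {-X..X} (\<lambda>x. a x * \<eta> 0 x) = (LBINT \<xi>. a \<xi> * \<eta> 0 \<xi>)"
  proof (intro LBINT_of_support[symmetric] continuous_intros)
    show "a \<xi> * \<eta> 0 \<xi> = 0" if "\<xi> \<notin> {-X..X}" for \<xi>
      using that support[of 0 \<xi>] X0 by force
  qed (auto intro!: continuous_on_time_slice[OF cont] continuous_on_subset[OF a])
  finally have initial: "(LBINT \<xi>. a \<xi> * \<eta> 0 \<xi>) =
      - integral {0..T} (\<lambda>t. integral {-X..X} (\<lambda>x. F t x * H t x + V t x * H' t x))"
    by simp

  have "integral {0..T} (\<lambda>t. LBINT \<xi>. f t \<xi> * \<eta> t \<xi> + w t \<xi> * (\<eta>t t \<xi> - of_real c * \<eta>x t \<xi>)) =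
      integral {0..T} (\<lambda>t. integral {-X..X} (\<lambda>x. F t x * H t x + W t x * H' t x))"
    unfolding F_def H_def W_def H'_def
    by (intro Henstock_Kurzweil_Integration.integral_cong LBINT_weak_integrand f w c X)
  with initial have "(LBINT \<xi>. a \<xi> * \<eta> 0 \<xi>) + integral {0..T} (\<lambda>t. LBINT \<xi>.
           f t \<xi> * \<eta> t \<xi> + w t \<xi> * (\<eta>t t \<xi> - of_real c * \<eta>x t \<xi>)) =
      integral {0..T} (\<lambda>t. integral {-X..X} (\<lambda>x. F t x * H t x + W t x * H' t x)) -
      integral {0..T} (\<lambda>t. integral {-X..X} (\<lambda>x. F t x * H t x + V t x * H' t x))"
    by simp
  also have "\<dots> = integral {0..T} (\<lambda>t. integral {-X..X} (\<lambda>x. F t x * H t x + W t x * H' t x) -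
      integral {-X..X} (\<lambda>x. F t x * H t x + V t x * H' t x))"
    by (intro Henstock_Kurzweil_Integration.integral_diff[symmetric] integrable_continuous_interval
        continuous_on_integral_space cP cQ) auto
  also have "\<dots> = integral {0..T} (\<lambda>t. integral {-X..X} (\<lambda>x. (W t x - V t x) * H' t x))"
  proof (intro Henstock_Kurzweil_Integration.integral_cong)
    fix t assume t: "t \<in> {0..T}"
    have "integral {-X..X} (\<lambda>x. F t x * H t x + W t x * H' t x) -
      integral {-X..X} (\<lambda>x. F t x * H t x + V t x * H' t x) =
      integral {-X..X} (\<lambda>x. (F t x * H t x + W t x * H' t x) - (F t x * H t x + V t x * H' t x))"
      using t by (intro Henstock_Kurzweil_Integration.integral_diff[symmetric]
          integrable_continuous_interval continuous_on_time_slice[OF cP] continuous_on_time_slice[OF cQ]) auto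
    then show "integral {-X..X} (\<lambda>x. F t x * H t x + W t x * H' t x) -
      integral {-X..X} (\<lambda>x. F t x * H t x + V t x * H' t x) =
      integral {-X..X} (\<lambda>x. (W t x - V t x) * H' t x)"
      by (simp add: algebra_simps)
  qed
  finally show ?thesis
    by (simp add: transport_defect_def W_def V_def F_def H'_def diff_diff_eq)
qed

end

section \<open>Test functions depending on a discrete mode\<close>

lemma at_within_atLeast_nontrivial:
  "t \<ge> (0::real) \<Longrightarrow> at t within {0..} \<noteq> bot"
  unfolding trivial_limit_within
  using islimpt_subset[OF islimpt_greaterThanLessThan1[of t "t + 1"], of "{0..}"] by force

lemma has_vector_derivative_zero_near:
  assumes "open U" "x \<in> U" "x \<in> S" "\<And>y. \<lbrakk>y \<in> S; y \<in> U\<rbrakk> \<Longrightarrow> f y = 0"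
  shows "(f has_vector_derivative 0) (at x within S)"
proof -
  obtain d where d: "d > 0" "ball x d \<subseteq> U"
    using assms(1,2) by (rule openE)
  show ?thesis
    by (rule has_vector_derivative_transform_within[OF has_vector_derivative_const[of 0] d(1)])
      (use assms d(2) in \<open>auto simp: subset_iff dist_commute\<close>)
qed

lemma continuous_on_mode:
  assumes "continuous_on spacetime_dom f" "l \<ge> 1"
  shows "continuous_on ({0..} \<times> UNIV) (\<lambda>(t, \<xi>). f (t, l, \<xi>))"
  unfolding case_prod_unfold using assms(2)
  by (intro continuous_on_compose2[OF assms(1)])
    (auto intro!: continuous_intros simp: spacetime_dom_def)

text \<open>As the mode index is discrete, each slice \<open>l = const\<close> is relatively open, so continuity may be
  checked mode by mode.\<close>

lemma continuous_on_spacetimeI: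
  fixes f :: "real \<times> nat \<times> real \<Rightarrow> complex"
  assumes "\<And>l. l \<ge> 1 \<Longrightarrow> continuous_on ({0..} \<times> UNIV) (\<lambda>(t, \<xi>). f (t, l, \<xi>))"
  shows "continuous_on spacetime_dom f"
  unfolding continuous_on_eq_continuous_within
proof
  fix p assume p: "p \<in> spacetime_dom"
  obtain t l \<xi> where [simp]: "p = (t, l, \<xi>)" by (cases p) auto
  have l: "l \<ge> 1" using p by (simp add: spacetime_dom_def)
  have "continuous_on spacetime_dom (\<lambda>q. case (fst q, snd (snd q)) of (t, \<xi>) \<Rightarrow> f (t, l, \<xi>))"
    by (rule continuous_on_compose2[OF assms[OF l]])
      (auto intro!: continuous_intros simp: spacetime_dom_def)
  then have 1: "continuous (at p within spacetime_dom) (\<lambda>q. f (fst q, l, snd (snd q)))"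
    using p by (simp add: continuous_on_eq_continuous_within)
  have "open ((UNIV :: real set) \<times> {l} \<times> (UNIV :: real set))"
    by (intro open_Times) (auto simp: open_discrete)
  then have 2: "openin (top_of_set spacetime_dom) (spacetime_dom \<inter> (UNIV \<times> {l} \<times> UNIV))"
    by (rule openin_open_Int)
  show "continuous (at p within spacetime_dom) f"
    by (rule continuous_transform_within_openin[OF 1 2]) (use p in auto)
qed

lemma C1_spacetimeI:
  assumes "\<And>l. l \<ge> 1 \<Longrightarrow> continuous_on ({0..} \<times> UNIV) (\<lambda>(t, \<xi>). h (t, l, \<xi>))"
    and ct: "\<And>l. l \<ge> 1 \<Longrightarrow> continuous_on ({0..} \<times> UNIV) (\<lambda>(t, \<xi>). ht t l \<xi>)"
    and cx: "\<And>l. l \<ge> 1 \<Longrightarrow> continuous_on ({0..} \<times> UNIV) (\<lambda>(t, \<xi>). hx t l \<xi>)"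
    and dt: "\<And>t l \<xi>. \<lbrakk>t \<ge> 0; l \<ge> 1\<rbrakk> \<Longrightarrow>
      ((\<lambda>\<tau>. h (\<tau>, l, \<xi>)) has_vector_derivative ht t l \<xi>) (at t within {0..})"
    and dx: "\<And>t l \<xi>. \<lbrakk>t \<ge> 0; l \<ge> 1\<rbrakk> \<Longrightarrow>
      ((\<lambda>x. h (t, l, x)) has_vector_derivative hx t l \<xi>) (at \<xi>)"
  shows "C1_spacetime h"
    and "\<lbrakk>t \<ge> 0; l \<ge> 1\<rbrakk> \<Longrightarrow> partial_t h (t, l, \<xi>) = ht t l \<xi>"
    and "\<lbrakk>t \<ge> 0; l \<ge> 1\<rbrakk> \<Longrightarrow> partial_xi h (t, l, \<xi>) = hx t l \<xi>"
proof -
  show t: "partial_t h (t, l, \<xi>) = ht t l \<xi>" if "t \<ge> 0" "l \<ge> 1" for t l \<xi>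
    unfolding partial_t_def using that by (simp add: vector_derivative_within[OF at_within_atLeast_nontrivial dt])
  show x: "partial_xi h (t, l, \<xi>) = hx t l \<xi>" if "t \<ge> 0" "l \<ge> 1" for t l \<xi>
    unfolding partial_xi_def using that by (simp add: vector_derivative_at[OF dx])
  show "C1_spacetime h"
    unfolding C1_spacetime_def
  proof (intro conjI continuous_on_spacetimeI assms)
    show "\<forall>(t, l, \<xi>)\<in>spacetime_dom. (\<lambda>\<tau>. h (\<tau>, l, \<xi>)) differentiable at t within {0..} \<and>
        (\<lambda>x. h (t, l, x)) differentiable at \<xi>"
      by (auto simp: spacetime_dom_def intro: differentiableI_vector[OF dt] differentiableI_vector[OF dx])
    show "continuous_on ({0..} \<times> UNIV) (\<lambda>(t, \<xi>). partial_t h (t, l, \<xi>))" if "l \<ge> 1" for l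
      using ct[OF that] by (rule continuous_on_eq) (use that t in auto)
    show "continuous_on ({0..} \<times> UNIV) (\<lambda>(t, \<xi>). partial_xi h (t, l, \<xi>))" if "l \<ge> 1" for l
      using cx[OF that] by (rule continuous_on_eq) (use that x in auto)
  qed
qed

text \<open>Compactness bounds the time, the frequency and also the number of modes involved. The last bound
  turns the series over the modes into finite sums.\<close>

lemma compactly_supported_iff:
  "compactly_supported h \<longleftrightarrow>
    (\<exists>T\<ge>0. \<exists>R\<ge>0. \<exists>L. \<forall>t l \<xi>. t \<ge> 0 \<longrightarrow> l \<ge> 1 \<longrightarrow> h (t, l, \<xi>) \<noteq> 0 \<longrightarrow> t \<le> T \<and> \<bar>\<xi>\<bar> \<le> R \<and> l \<le> L)"
  (is "_ \<longleftrightarrow> ?bounds")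
proof
  define S where "S = {p \<in> spacetime_dom. h p \<noteq> 0}"
  assume "compactly_supported h"
  then have K: "compact (closure S)"
    by (simp add: compactly_supported_def S_def)
  have sup: "\<exists>b. \<forall>p\<in>S. f p \<le> b" if "continuous_on UNIV f"
    for f :: "real \<times> nat \<times> real \<Rightarrow> 'b::linorder_topology"
  proof (cases "S = {}")
    case False
    then have "closure S \<noteq> {}" by simp
    from continuous_attains_sup[OF K this continuous_on_subset[OF that]] show ?thesis
      using closure_subset by blast
  qed auto
  obtain T where T: "\<And>p. p \<in> S \<Longrightarrow> fst p \<le> T"
    using sup[OF continuous_on_fst[OF continuous_on_id]] by blast
  obtain R where R: "\<And>p. p \<in> S \<Longrightarrow> \<bar>snd (snd p)\<bar> \<le> R"
    using sup[OF continuous_on_rabs[OF continuous_on_snd[OF continuous_on_snd[OF continuous_on_id]]]] by blast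
  obtain L where L: "\<And>p. p \<in> S \<Longrightarrow> fst (snd p) \<le> L"
    using sup[OF continuous_on_fst[OF continuous_on_snd[OF continuous_on_id]]] by blast
  have "t \<le> max 0 T \<and> \<bar>\<xi>\<bar> \<le> max 0 R \<and> l \<le> L"
    if "t \<ge> 0" "l \<ge> 1" "h (t, l, \<xi>) \<noteq> 0" for t l \<xi>
  proof -
    have S: "(t, l, \<xi>) \<in> S" using that by (simp add: S_def spacetime_dom_def)
    show ?thesis using T[OF S] R[OF S] L[OF S] by auto
  qed
  then show ?bounds
    by (intro exI[of _ "max 0 T"] exI[of _ "max 0 R"] exI[of _ L] conjI allI impI) auto
next
  assume ?bounds
  then obtain T R L where *: "\<And>t l \<xi>. \<lbrakk>t \<ge> 0; l \<ge> 1; h (t, l, \<xi>) \<noteq> 0\<rbrakk> \<Longrightarrow> t \<le> T \<and> \<bar>\<xi>\<bar> \<le> R \<and> l \<le> L"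
    by blast
  have "{p \<in> spacetime_dom. h p \<noteq> 0} \<subseteq> {0..T} \<times> {1..L} \<times> {-R..R}"
    using * by (force simp: spacetime_dom_def)
  moreover have c: "compact ({0..T} \<times> {1..L} \<times> {-R..R})"
    by (intro compact_Times) (auto simp: finite_imp_compact)
  ultimately have "closure {p \<in> spacetime_dom. h p \<noteq> 0} \<subseteq> {0..T} \<times> {1..L} \<times> {-R..R}"
    by (intro closure_minimal compact_imp_closed)
  then show "compactly_supported h"
    using compact_Int_closed[OF c closed_closure[of "{p \<in> spacetime_dom. h p \<noteq> 0}"]]
    unfolding compactly_supported_def by (simp only: Int_absorb1)
qed

text \<open>With explicit bounds common to a test function and its partial derivatives, the weak form becomes a
  finite sum of integrals over a fixed rectangle.\<close>

locale test_function =
  fixes h :: "real \<times> nat \<times> real \<Rightarrow> complex" and T R :: real and L :: nat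
  assumes L: "L \<ge> 1" and T_nonneg: "T \<ge> 0"
    and profile: "l \<ge> 1 \<Longrightarrow> test_profile (\<lambda>t \<xi>. h (t, l, \<xi>))
      (\<lambda>t \<xi>. partial_t h (t, l, \<xi>)) (\<lambda>t \<xi>. partial_xi h (t, l, \<xi>)) T R"
    and high_modes: "\<lbrakk>t \<ge> 0; l > L\<rbrakk> \<Longrightarrow>
      h (t, l, \<xi>) = 0 \<and> partial_t h (t, l, \<xi>) = 0 \<and> partial_xi h (t, l, \<xi>) = 0"

text \<open>Where the function vanishes on a neighbourhood, so do its derivatives. This covers the open
  complement of the bounds; enlarging them by one provides the closed conditions of a profile.\<close>

lemma test_functionI:
  assumes h: "C1_spacetime h" and T: "T \<ge> 0" and L: "L \<ge> 1"
    and supp: "\<And>t l \<xi>. \<lbrakk>t \<ge> 0; l \<ge> 1; h (t, l, \<xi>) \<noteq> 0\<rbrakk> \<Longrightarrow> t \<le> T \<and> \<bar>\<xi>\<bar> \<le> R \<and> l \<le> L"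
  shows "test_function h (T + 1) (R + 1) L"
proof -
  have dt: "((\<lambda>\<tau>. h (\<tau>, l, \<xi>)) has_vector_derivative partial_t h (t, l, \<xi>)) (at t within {0..})"
    if "t \<ge> 0" "l \<ge> 1" for t l \<xi>
    using h that unfolding C1_spacetime_def spacetime_dom_def partial_t_def
    by (auto simp: vector_derivative_works)
  have dx: "((\<lambda>x. h (t, l, x)) has_vector_derivative partial_xi h (t, l, \<xi>)) (at \<xi>)"
    if "t \<ge> 0" "l \<ge> 1" for t l \<xi>
    using h that unfolding C1_spacetime_def spacetime_dom_def partial_xi_def
    by (auto simp: vector_derivative_works)
  have zero: "h (t, l, \<xi>) = 0 \<and> partial_t h (t, l, \<xi>) = 0 \<and> partial_xi h (t, l, \<xi>) = 0"
    if t: "t \<ge> 0" and l: "l \<ge> 1" and out: "T < t \<or> R < \<bar>\<xi>\<bar> \<or> L < l" for t l \<xi>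
  proof -
    have h0: "h (s, l, y) = 0" if "s \<ge> 0" "T < s \<or> R < \<bar>y\<bar> \<or> L < l" for s y
      using supp[of s l y] l that by force
    define U where "U = (if R < \<bar>\<xi>\<bar> \<or> L < l then UNIV else {T<..})"
    have "((\<lambda>\<tau>. h (\<tau>, l, \<xi>)) has_vector_derivative 0) (at t within {0..})"
      by (rule has_vector_derivative_zero_near[of U]) (use t h0 out in \<open>auto simp: U_def split: if_splits\<close>)
    then have "partial_t h (t, l, \<xi>) = 0"
      using vector_derivative_within[OF at_within_atLeast_nontrivial[OF t]] by (simp add: partial_t_def)
    moreover define Y :: "real set" where "Y = (if T < t \<or> L < l then UNIV else - cball 0 R)"
    have "((\<lambda>x. h (t, l, x)) has_vector_derivative 0) (at \<xi>)"
      by (rule has_vector_derivative_zero_near[of Y]) (use t h0 out in \<open>auto simp: Y_def split: if_splits\<close>)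
    then have "partial_xi h (t, l, \<xi>) = 0"
      by (simp add: partial_xi_def vector_derivative_at)
    ultimately show ?thesis using h0[OF t out] by simp
  qed
  show ?thesis
  proof (rule test_function.intro)
    show "L \<ge> 1" "T + 1 \<ge> 0" using L T by auto
    show "h (t, l, \<xi>) = 0 \<and> partial_t h (t, l, \<xi>) = 0 \<and> partial_xi h (t, l, \<xi>) = 0"
      if "t \<ge> 0" "l > L" for t l \<xi> using zero[of t l \<xi>] that L by auto
    show "test_profile (\<lambda>t \<xi>. h (t, l, \<xi>))
      (\<lambda>t \<xi>. partial_t h (t, l, \<xi>)) (\<lambda>t \<xi>. partial_xi h (t, l, \<xi>)) (T + 1) (R + 1)" if "l \<ge> 1" for l
    proof (rule test_profile.intro)
      show "T + 1 \<ge> 0" using T by simp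
      show "h (t, l, \<xi>) = 0 \<and> partial_t h (t, l, \<xi>) = 0 \<and> partial_xi h (t, l, \<xi>) = 0"
        if "t \<ge> 0" "T + 1 \<le> t \<or> R + 1 \<le> \<bar>\<xi>\<bar>" for t \<xi> using zero[of t l \<xi>] that \<open>l \<ge> 1\<close> by auto
    qed (use h dt dx that in \<open>auto simp: C1_spacetime_def intro!: continuous_on_mode\<close>)
  qed
qed

section \<open>The weak form as a sum over modes\<close>

text \<open>The system as a family of transport equations: only the first mode has a source, which is nonlocal
  because it contains the trace of the unknown at \<open>\<xi> = 0\<close>.\<close>

definition mode_source ::
  "real \<Rightarrow> (real \<Rightarrow> complex) \<Rightarrow> (real \<times> nat \<times> real \<Rightarrow> complex) \<Rightarrow> nat \<Rightarrow> real \<Rightarrow> real \<Rightarrow> complex"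
  where "mode_source K ghat u l t \<xi> =
    (if l = 1 then of_real (K / 2) * u (t, 1, 0) * ghat \<xi> else 0)"

definition mode_defect ::
  "real \<Rightarrow> (real \<Rightarrow> complex) \<Rightarrow> (nat \<times> real \<Rightarrow> complex) \<Rightarrow> (real \<times> nat \<times> real \<Rightarrow> complex) \<Rightarrow>
    nat \<Rightarrow> real \<Rightarrow> real \<Rightarrow> complex"
  where "mode_defect K ghat u_in u l =
    transport_defect (real l) (\<lambda>x. u_in (l, x)) (mode_source K ghat u l) (\<lambda>t \<xi>. u (t, l, \<xi>))"

definition weak_form ::
  "real \<Rightarrow> (real \<Rightarrow> complex) \<Rightarrow> (nat \<times> real \<Rightarrow> complex) \<Rightarrow> (real \<times> nat \<times> real \<Rightarrow> complex) \<Rightarrow>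
    (real \<times> nat \<times> real \<Rightarrow> complex) \<Rightarrow> complex"
  where "weak_form K ghat u_in u h =
    (\<Sum>\<^sub>\<infinity>l\<in>{1..}. (LBINT \<xi>. (u_in (l, \<xi>) * h (0, l, \<xi>))))
    + (LBINT t:{0..}. (LBINT \<xi>.
        (complex_of_real (K / 2) * u (t, 1, 0) * ghat \<xi> * h (t, 1, \<xi>)
       + (\<Sum>\<^sub>\<infinity>l\<in>{1..}. u (t, l, \<xi>) *
            (partial_t h (t, l, \<xi>) - of_nat l * partial_xi h (t, l, \<xi>))))))"

lemma continuous_on_initial_mode:
  assumes "continuous_on mode_dom a" "l \<ge> 1"
  shows "continuous_on S (\<lambda>x. a (l, x))"
  using assms(2)
  by (intro continuous_on_compose2[OF assms(1)])
    (auto intro!: continuous_intros simp: mode_dom_def)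

lemma continuous_on_mode_source:
  assumes g: "continuous_on UNIV ghat" and u: "continuous_on spacetime_dom u"
  shows "continuous_on ({0..} \<times> UNIV) (\<lambda>(t, \<xi>). mode_source K ghat u l t \<xi>)"
proof (cases "l = 1")
  case True
  have "continuous_on ({0..} \<times> UNIV) (\<lambda>q. u (fst q, 1, 0))"
    by (intro continuous_on_compose2[OF u]) (auto intro!: continuous_intros simp: spacetime_dom_def)
  then show ?thesis
    unfolding mode_source_def case_prod_unfold using True
    by (auto intro!: continuous_intros continuous_on_compose2[OF g])
qed (simp add: mode_source_def case_prod_unfold)

context test_function
begin

lemma infsum_modes:
  assumes "\<And>l. l > L \<Longrightarrow> f l = (0::complex)"
  shows "(\<Sum>\<^sub>\<infinity>l\<in>{1..}. f l) = (\<Sum>l=1..L. f l)"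
proof -
  have "(\<Sum>\<^sub>\<infinity>l\<in>{1..}. f l) = (\<Sum>\<^sub>\<infinity>l\<in>{1..L}. f l)"
    by (rule infsum_cong_neutral) (use assms in auto)
  then show ?thesis by simp
qed

text \<open>The source depends on the unknown, but once the unknown is given it is just a continuous function of
  time and frequency. Hence the identity for a single transport equation applies to each mode.\<close>

lemma weak_form_eq_sum_defects:
  assumes g: "continuous_on UNIV ghat" and a: "continuous_on mode_dom u_in"
    and u: "continuous_on spacetime_dom u" and X: "R + real L * T \<le> X"
  shows "weak_form K ghat u_in u h =
    (\<Sum>l=1..L. integral {0..T} (\<lambda>t. integral {-X..X} (\<lambda>x. mode_defect K ghat u_in u l t x *
      (partial_t h (t, l, x - real l * t) - of_nat l * partial_xi h (t, l, x - real l * t)))))"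
proof -
  define I where "I l t \<xi> = mode_source K ghat u l t \<xi> * h (t, l, \<xi>) +
    u (t, l, \<xi>) * (partial_t h (t, l, \<xi>) - of_real (real l) * partial_xi h (t, l, \<xi>))" for l t \<xi>
  define J where "J t = (LBINT \<xi>. complex_of_real (K / 2) * u (t, 1, 0) * ghat \<xi> * h (t, 1, \<xi>)
       + (\<Sum>\<^sub>\<infinity>l\<in>{1..}. u (t, l, \<xi>) *
            (partial_t h (t, l, \<xi>) - of_nat l * partial_xi h (t, l, \<xi>))))" for t
  note src = continuous_on_mode_source[OF g u, of K]
  note mode = continuous_on_mode[OF u]
  have J_modes: "J t = (LBINT \<xi>. \<Sum>l=1..L. I l t \<xi>)" if t: "t \<ge> 0" for t
  proof -
    have "(\<Sum>l=1..L. mode_source K ghat u l t \<xi> * h (t, l, \<xi>)) =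
        complex_of_real (K / 2) * u (t, 1, 0) * ghat \<xi> * h (t, 1, \<xi>)" for \<xi>
    proof -
      have "(\<Sum>l=1..L. mode_source K ghat u l t \<xi> * h (t, l, \<xi>)) =
          (\<Sum>l\<in>{1}. mode_source K ghat u l t \<xi> * h (t, l, \<xi>))"
        using L by (intro sum.mono_neutral_right) (auto simp: mode_source_def)
      then show ?thesis by (simp add: mode_source_def)
    qed
    moreover have "(\<Sum>\<^sub>\<infinity>l\<in>{1..}. u (t, l, \<xi>) *
          (partial_t h (t, l, \<xi>) - of_nat l * partial_xi h (t, l, \<xi>))) =
        (\<Sum>l=1..L. u (t, l, \<xi>) *
          (partial_t h (t, l, \<xi>) - of_nat l * partial_xi h (t, l, \<xi>)))" for \<xi>
      using high_modes[OF t] by (intro infsum_modes) auto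
    ultimately show ?thesis
      unfolding J_def I_def sum.distrib of_real_of_nat_eq by (simp only:)
  qed
  have J_sum: "J t = (\<Sum>l=1..L. LBINT \<xi>. I l t \<xi>)" if t: "t \<in> {0..T}" for t
  proof -
    have "integrable lborel (I l t)" if "l \<in> {1..L}" for l
      unfolding I_def using that t
      by (intro test_profile.integrable_weak_integrand[OF profile src mode _ _ order_refl]) auto
    then show ?thesis
      using J_modes[of t] t by (simp add: Bochner_Integration.integral_sum)
  qed
  have J_zero: "J t = 0" if "t > T" for t
  proof -
    have "I l t \<xi> = 0" if "l \<in> {1..L}" for l \<xi>
      using test_profile.support[OF profile, of l t \<xi>] that \<open>t > T\<close> T_nonneg by (simp add: I_def)
    then show ?thesis using J_modes[of t] that T_nonneg by simp
  qed
  have cont: "continuous_on {0..T} (\<lambda>t. LBINT \<xi>. I l t \<xi>)" if "l \<in> {1..L}" for l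
    unfolding I_def using that
    by (intro test_profile.continuous_on_LBINT_weak_integrand[OF profile src mode]) auto
  have "(LBINT t:{0..}. J t) = (LBINT t:{0..T}. J t)"
    unfolding set_lebesgue_integral_def
    by (intro Bochner_Integration.integral_cong) (auto simp: indicator_def J_zero)
  also have "\<dots> = (LBINT t:{0..T}. \<Sum>l=1..L. LBINT \<xi>. I l t \<xi>)"
    unfolding set_lebesgue_integral_def
    by (intro Bochner_Integration.integral_cong) (auto simp: indicator_def J_sum)
  also have "\<dots> = integral {0..T} (\<lambda>t. \<Sum>l=1..L. LBINT \<xi>. I l t \<xi>)"
    by (intro set_LBINT_eq_integral continuous_intros cont)
  also have "\<dots> = (\<Sum>l=1..L. integral {0..T} (\<lambda>t. LBINT \<xi>. I l t \<xi>))"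
    by (intro Henstock_Kurzweil_Integration.integral_sum integrable_continuous_interval cont) auto
  finally have "weak_form K ghat u_in u h = (\<Sum>l=1..L. (LBINT \<xi>. u_in (l, \<xi>) * h (0, l, \<xi>)) +
      integral {0..T} (\<lambda>t. LBINT \<xi>. I l t \<xi>))"
    unfolding weak_form_def J_def[symmetric] using high_modes[of 0]
    by (subst infsum_modes) (auto simp: sum.distrib)
  also have "\<dots> = (\<Sum>l=1..L. integral {0..T} (\<lambda>t. integral {-X..X} (\<lambda>x. mode_defect K ghat u_in u l t x *
      (partial_t h (t, l, x - real l * t) - of_real (real l) * partial_xi h (t, l, x - real l * t)))))"
  proof (rule sum.cong[OF refl])
    fix l assume l: "l \<in> {1..L}"
    then have "real l * T \<le> real L * T" using T_nonneg by (intro mult_right_mono) auto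
    with X have "R + real l * T \<le> X" by simp
    with l show "(LBINT \<xi>. u_in (l, \<xi>) * h (0, l, \<xi>)) + integral {0..T} (\<lambda>t. LBINT \<xi>. I l t \<xi>) =
        integral {0..T} (\<lambda>t. integral {-X..X} (\<lambda>x. mode_defect K ghat u_in u l t x *
          (partial_t h (t, l, x - real l * t) - of_real (real l) * partial_xi h (t, l, x - real l * t))))"
      unfolding I_def mode_defect_def
      by (intro test_profile.weak_form_eq_defect[OF profile _ src mode] continuous_on_initial_mode[OF a]) auto
  qed
  finally show ?thesis by simp
qed

end

lemma weak_form_zero_of_mild:
  assumes g: "continuous_on UNIV ghat" and a: "continuous_on mode_dom u_in"
    and u: "continuous_on spacetime_dom u" and h: "C1_spacetime h" "compactly_supported h"
    and mild: "\<And>l t x. \<lbrakk>l \<ge> 1; t \<ge> 0\<rbrakk> \<Longrightarrow> mode_defect K ghat u_in u l t x = 0"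
  shows "weak_form K ghat u_in u h = 0"
proof -
  obtain T R L where "T \<ge> 0" and
    bounds: "\<And>t l \<xi>. \<lbrakk>t \<ge> 0; l \<ge> 1; h (t, l, \<xi>) \<noteq> 0\<rbrakk> \<Longrightarrow> t \<le> T \<and> \<bar>\<xi>\<bar> \<le> R \<and> l \<le> L"
    using h(2) unfolding compactly_supported_iff by blast
  then have "test_function h (T + 1) (R + 1) (max 1 L)"
    using h(1) by (intro test_functionI) (auto simp: le_max_iff_disj)
  note test_function.weak_form_eq_sum_defects[OF this g a u order_refl, of K]
  moreover have "integral {0..T'} (\<lambda>t. integral S (\<lambda>x. mode_defect K ghat u_in u l t x * G t x)) = 0"
    if "l \<ge> 1" for l G T' S
  proof -
    have "integral {0..T'} (\<lambda>t. integral S (\<lambda>x. mode_defect K ghat u_in u l t x * G t x)) =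
        integral {0..T'} (\<lambda>t. 0)"
      by (rule Henstock_Kurzweil_Integration.integral_cong) (simp add: mild[OF that])
    then show ?thesis by simp
  qed
  ultimately show ?thesis by (simp add: sum.neutral)
qed

section \<open>Testing with bump functions\<close>

lemma has_real_derivative_positive_part_squared:
  "((\<lambda>y::real. (max 0 y)\<^sup>2) has_real_derivative 2 * max 0 y) (at y)"
proof -
  consider "y > 0" | "y < 0" | "y = 0" by linarith
  then show ?thesis
  proof cases
    case 1
    have "((\<lambda>y. y\<^sup>2) has_real_derivative 2 * y) (at y)"
      by (auto intro!: derivative_eq_intros)
    then show ?thesis
      using 1 by (auto intro: has_field_derivative_transform_within_open[where S = "{0<..}"])
  next
    case 2
    then show ?thesis
      by (auto intro: has_field_derivative_transform_within_open[OF DERIV_const[of 0], where S = "{..<0}"])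
  next
    case 3
    have "((\<lambda>h::real. (max 0 h)\<^sup>2 / h) \<longlongrightarrow> 0) (at 0)"
      by (rule Lim_null_comparison[where g = "\<lambda>h. \<bar>h\<bar>"])
        (auto intro!: always_eventually tendsto_eq_intros simp: max_def power2_eq_square)
    then show ?thesis using 3 by (simp add: DERIV_def)
  qed
qed

text \<open>Squaring the positive part makes the derivative \<open>2 * max 0 y\<close> continuous at zero as well, so the
  bump is continuously differentiable.\<close>

lemma bump_function_exists:
  assumes "\<epsilon> > 0"
  obtains \<beta> \<beta>' :: "real \<Rightarrow> real" where
    "\<And>x. (\<beta> has_real_derivative \<beta>' x) (at x)" "continuous_on UNIV \<beta>'"
    "\<And>x. \<beta> x \<ge> 0" "\<And>x. \<epsilon> \<le> \<bar>x - c\<bar> \<Longrightarrow> \<beta> x = 0" "\<beta> c > 0"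
proof
  let ?\<beta> = "\<lambda>x. (max 0 (\<epsilon>\<^sup>2 - (x - c)\<^sup>2))\<^sup>2"
  show "(?\<beta> has_real_derivative 2 * max 0 (\<epsilon>\<^sup>2 - (x - c)\<^sup>2) * (- 2 * (x - c))) (at x)" for x
  proof (rule DERIV_chain2[OF has_real_derivative_positive_part_squared])
    show "((\<lambda>x. \<epsilon>\<^sup>2 - (x - c)\<^sup>2) has_real_derivative - 2 * (x - c)) (at x)"
      by (auto intro!: derivative_eq_intros)
  qed
  show "continuous_on UNIV (\<lambda>x. 2 * max 0 (\<epsilon>\<^sup>2 - (x - c)\<^sup>2) * (- 2 * (x - c)))"
    by (intro continuous_intros)
  show "?\<beta> x = 0" if "\<epsilon> \<le> \<bar>x - c\<bar>" for x
  proof -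
    have "\<epsilon>\<^sup>2 \<le> \<bar>x - c\<bar>\<^sup>2" using that assms by (intro power_mono) auto
    then show ?thesis by simp
  qed
qed (use assms in auto)

lemma integral_Re:
  fixes f :: "real \<Rightarrow> complex"
  assumes "continuous_on {a..b} f"
  shows "integral {a..b} (\<lambda>x. Re (f x)) = Re (integral {a..b} f)"
  using integral_linear[OF integrable_continuous_interval[OF assms] bounded_linear_Re]
  by (simp add: o_def)

text \<open>If \<open>d x0 \<noteq> 0\<close>, then the real part of \<open>d x * cnj (d x0)\<close> is positive near \<open>x0\<close>, and
  integrating it against a small bump at \<open>x0\<close> gives a positive number.\<close>

lemma fundamental_lemma_bump:
  fixes d :: "real \<Rightarrow> complex"
  assumes d: "continuous_on UNIV d" and X: "\<bar>x0\<bar> < X"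
    and zero: "\<And>\<beta> \<beta>' :: real \<Rightarrow> real. \<lbrakk>\<And>x. (\<beta> has_real_derivative \<beta>' x) (at x); continuous_on UNIV \<beta>';
      \<And>x. 1 \<le> \<bar>x - x0\<bar> \<Longrightarrow> \<beta> x = 0\<rbrakk> \<Longrightarrow> integral {-X..X} (\<lambda>x. d x * of_real (\<beta> x)) = 0"
  shows "d x0 = 0"
proof (rule ccontr)
  assume nz: "d x0 \<noteq> 0"
  define p where "p x = Re (d x * cnj (d x0))" for x
  have p: "continuous_on UNIV p"
    unfolding p_def by (intro continuous_intros d)
  have p0: "p x0 > 0"
  proof -
    have "p x0 = (cmod (d x0))\<^sup>2" by (simp add: p_def complex_mult_cnj cmod_power2)
    then show ?thesis using nz by simp
  qed
  have "open (p -` {0<..})" using p by (simp add: continuous_on_open_vimage)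
  moreover have "x0 \<in> p -` {0<..}" using p0 by simp
  ultimately obtain e where e: "e > 0" "ball x0 e \<subseteq> p -` {0<..}"
    by (rule openE)
  obtain \<beta> \<beta>' where \<beta>: "\<And>x. (\<beta> has_real_derivative \<beta>' x) (at x)" "continuous_on UNIV \<beta>'"
    "\<And>x. \<beta> x \<ge> 0" "\<And>x. min e 1 \<le> \<bar>x - x0\<bar> \<Longrightarrow> \<beta> x = 0" "\<beta> x0 > 0"
    using bump_function_exists[of "min e 1" x0] e(1) by auto
  have c\<beta>: "continuous_on UNIV \<beta>"
    using \<beta>(1) by (meson DERIV_isCont continuous_at_imp_continuous_on)
  have cd: "continuous_on {-X..X} (\<lambda>x. d x * of_real (\<beta> x))"
    by (intro continuous_intros continuous_on_subset[OF d] continuous_on_subset[OF c\<beta>]) auto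
  have nonneg: "p x * \<beta> x \<ge> 0" for x
  proof (cases "min e 1 \<le> \<bar>x - x0\<bar>")
    case False
    then have "x \<in> ball x0 e" by (auto simp: dist_real_def)
    with e(2) have "p x > 0" by auto
    then show ?thesis using \<beta>(3) by simp
  qed (simp add: \<beta>(4))
  have "integral {-X..X} (\<lambda>x. p x * \<beta> x) = integral {-X..X} (\<lambda>x. Re ((d x * of_real (\<beta> x)) * cnj (d x0)))"
    by (simp add: p_def algebra_simps)
  also have "\<dots> = Re (integral {-X..X} (\<lambda>x. (d x * of_real (\<beta> x)) * cnj (d x0)))"
    by (intro integral_Re continuous_intros cd)
  also have "integral {-X..X} (\<lambda>x. (d x * of_real (\<beta> x)) * cnj (d x0)) = 0"
    using zero[OF \<beta>(1,2)] \<beta>(4) by simp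
  finally have "integral {-X..X} (\<lambda>x. p x * \<beta> x) = 0" by simp
  moreover have "continuous_on {-X..X} (\<lambda>x. p x * \<beta> x)"
    by (intro continuous_intros continuous_on_subset[OF p] continuous_on_subset[OF c\<beta>]) auto
  ultimately have "\<forall>x\<in>{-X..X}. p x * \<beta> x = 0"
    using integral_eq_0_iff[of "-X" X "\<lambda>x. p x * \<beta> x"] nonneg X by auto
  moreover have "x0 \<in> {-X..X}" using X by auto
  ultimately have "p x0 * \<beta> x0 = 0" by blast
  with p0 \<beta>(5) show False by simp
qed

text \<open>In characteristic coordinates this test function is the product \<open>A t * \<beta> x\<close>, supported on a single
  mode; the transport operator therefore acts on the first factor only and yields \<open>\<alpha> t * \<beta> x\<close>. As
  \<open>A\<close> need not vanish at time zero, every continuous \<open>\<alpha>\<close> that vanishes from time \<open>T\<close> on arises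
  in this way.\<close>

lemma separated_test_function:
  fixes A \<alpha> :: "real \<Rightarrow> complex" and \<beta> \<beta>' :: "real \<Rightarrow> real"
  assumes A: "\<And>t. t \<ge> 0 \<Longrightarrow> (A has_vector_derivative \<alpha> t) (at t within {0..})"
    and \<alpha>: "continuous_on {0..} \<alpha>"
    and A0: "\<And>t. t \<ge> T \<Longrightarrow> A t = 0"
    and \<beta>: "\<And>x. (\<beta> has_real_derivative \<beta>' x) (at x)"
    and \<beta>': "continuous_on UNIV \<beta>'"
    and \<beta>0: "\<And>x. b \<le> \<bar>x\<bar> \<Longrightarrow> \<beta> x = 0"
    and T: "T \<ge> 0" and b: "b \<ge> 0" and l0: "l0 \<ge> 1"
  defines "h \<equiv> \<lambda>(t, l, \<xi>). if l = l0 then A t * of_real (\<beta> (\<xi> + real l0 * t)) else 0"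
  shows "C1_spacetime h" and "compactly_supported h"
    and "test_function h (T + 1) (b + real l0 * T + 1) l0"
    and "\<lbrakk>t \<ge> 0; l \<ge> 1\<rbrakk> \<Longrightarrow>
      partial_t h (t, l, x - real l * t) - of_nat l * partial_xi h (t, l, x - real l * t) =
      (if l = l0 then \<alpha> t * of_real (\<beta> x) else 0)"
proof -
  define ht where "ht t l \<xi> = (if l = l0 then \<alpha> t * of_real (\<beta> (\<xi> + real l0 * t)) +
    A t * of_real (real l0 * \<beta>' (\<xi> + real l0 * t)) else 0)" for t l \<xi>
  define hx where "hx t l \<xi> = (if l = l0 then A t * of_real (\<beta>' (\<xi> + real l0 * t)) else 0)" for t l \<xi>
  have cA: "continuous_on {0..} A"
    using A by (auto simp: continuous_on_eq_continuous_within intro: has_vector_derivative_continuous)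
  have c\<beta>: "continuous_on UNIV \<beta>"
    using \<beta> by (meson DERIV_isCont continuous_at_imp_continuous_on)
  note cont = continuous_intros continuous_on_compose2[OF c\<beta>] continuous_on_compose2[OF \<beta>']
    continuous_on_compose2[OF cA] continuous_on_compose2[OF \<alpha>]
  have 1: "continuous_on ({0..} \<times> UNIV) (\<lambda>(t, \<xi>). h (t, l, \<xi>))" for l
    unfolding h_def case_prod_unfold by (cases "l = l0") (auto intro!: cont)
  have 2: "continuous_on ({0..} \<times> UNIV) (\<lambda>(t, \<xi>). ht t l \<xi>)" for l
    unfolding ht_def case_prod_unfold by (cases "l = l0") (auto intro!: cont)
  have 3: "continuous_on ({0..} \<times> UNIV) (\<lambda>(t, \<xi>). hx t l \<xi>)" for l
    unfolding hx_def case_prod_unfold by (cases "l = l0") (auto intro!: cont)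
  have 4: "((\<lambda>\<tau>. h (\<tau>, l, \<xi>)) has_vector_derivative ht t l \<xi>) (at t within {0..})" if "t \<ge> 0" for t l \<xi>
  proof (cases "l = l0")
    case True
    have "((\<lambda>\<tau>. \<beta> (\<xi> + real l0 * \<tau>)) has_real_derivative real l0 * \<beta>' (\<xi> + real l0 * t)) (at t within {0..})"
      by (rule DERIV_subset[OF DERIV_cong[OF DERIV_chain2[OF \<beta>]]]) (auto intro!: derivative_eq_intros)
    then have "((\<lambda>\<tau>. complex_of_real (\<beta> (\<xi> + real l0 * \<tau>))) has_vector_derivative
        of_real (real l0 * \<beta>' (\<xi> + real l0 * t))) (at t within {0..})"
      by (rule has_vector_derivative_of_real)
    from has_vector_derivative_mult[OF A[OF that] this] True show ?thesis
      by (simp add: h_def ht_def add.commute)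
  qed (simp add: h_def ht_def)
  have 5: "((\<lambda>x. h (t, l, x)) has_vector_derivative hx t l \<xi>) (at \<xi>)" for t l \<xi>
  proof (cases "l = l0")
    case True
    have "((\<lambda>x. \<beta> (x + real l0 * t)) has_real_derivative \<beta>' (\<xi> + real l0 * t)) (at \<xi>)"
      by (rule DERIV_cong[OF DERIV_chain2[OF \<beta>]]) (auto intro!: derivative_eq_intros)
    then have "((\<lambda>x. complex_of_real (\<beta> (x + real l0 * t))) has_vector_derivative
        of_real (\<beta>' (\<xi> + real l0 * t))) (at \<xi>)"
      by (rule has_vector_derivative_of_real)
    from has_vector_derivative_mult[OF has_vector_derivative_const[of "A t"] this] True show ?thesis
      by (simp add: h_def hx_def)
  qed (simp add: h_def hx_def)
  note C1 = C1_spacetimeI[OF 1 2 3 4 5]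
  show h: "C1_spacetime h" by (rule C1(1))
  have bounds: "t \<le> T \<and> \<bar>\<xi>\<bar> \<le> b + real l0 * T \<and> l \<le> l0"
    if t: "t \<ge> 0" and nz: "h (t, l, \<xi>) \<noteq> 0" for t l \<xi>
  proof -
    have [simp]: "l = l0" using nz by (auto simp: h_def split: if_splits)
    have tT: "t \<le> T" using A0[of t] nz by (force simp: h_def)
    have "\<bar>\<xi> + real l0 * t\<bar> \<le> b" using \<beta>0[of "\<xi> + real l0 * t"] nz by (force simp: h_def)
    moreover have "real l0 * t \<le> real l0 * T" "0 \<le> real l0 * t" using tT t by (auto intro: mult_left_mono)
    ultimately have "\<bar>\<xi>\<bar> \<le> b + real l0 * T" by linarith
    with tT show ?thesis by simp
  qed
  have "b + real l0 * T \<ge> 0" using b T by simp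
  then show "compactly_supported h"
    unfolding compactly_supported_iff using bounds T by blast
  show "test_function h (T + 1) (b + real l0 * T + 1) l0"
    by (rule test_functionI[OF h T l0]) (use bounds in auto)
  show "partial_t h (t, l, x - real l * t) - of_nat l * partial_xi h (t, l, x - real l * t) =
      (if l = l0 then \<alpha> t * of_real (\<beta> x) else 0)" if "t \<ge> 0" "l \<ge> 1"
    using that by (simp add: C1 ht_def hx_def)
qed

text \<open>Let \<open>E s\<close> be the integral of the residual at time \<open>s\<close> against a spatial bump. Testing with the
  product whose time factor has derivative \<open>\<alpha> s = cnj (E s) * (T - s)\<close> for \<open>s \<le> T\<close> gives
  \<open>\<integral> (T - s) |E s|\<^sup>2 ds = 0\<close> over \<open>[0, T]\<close>. Therefore \<open>E = 0\<close> before time \<open>T\<close>, without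
  localizing in time, and the spatial bumps then detect the residual pointwise.\<close>

lemma mild_of_weak_form_zero:
  assumes g: "continuous_on UNIV ghat" and a: "continuous_on mode_dom u_in"
    and u: "continuous_on spacetime_dom u"
    and weak: "\<And>h. \<lbrakk>C1_spacetime h; compactly_supported h\<rbrakk> \<Longrightarrow> weak_form K ghat u_in u h = 0"
    and l: "l \<ge> 1" and t: "t \<ge> 0"
  shows "mode_defect K ghat u_in u l t x0 = 0"
proof -
  define T where "T = t + 1"
  define b where "b = \<bar>x0\<bar> + 1"
  define X where "X = b + real l * T + 1 + real l * (T + 1)"
  have T: "T \<ge> 0" and b: "b \<ge> 0" using t by (auto simp: T_def b_def)
  have "real l * T \<ge> 0" "real l * (T + 1) \<ge> 0" using T by auto
  then have X: "\<bar>x0\<bar> < X" unfolding X_def b_def by linarith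
  have cD: "continuous_on ({0..} \<times> UNIV) (\<lambda>(t, x). mode_defect K ghat u_in u l t x)"
    unfolding mode_defect_def
    by (intro continuous_on_transport_defect continuous_on_initial_mode[OF a l]
        continuous_on_mode_source g u continuous_on_mode l)
  show ?thesis
  proof (rule fundamental_lemma_bump[where d = "mode_defect K ghat u_in u l t", OF _ X])
    show "continuous_on UNIV (mode_defect K ghat u_in u l t)"
      by (rule continuous_on_time_slice[OF cD t])
  next
    fix \<beta> \<beta>' :: "real \<Rightarrow> real"
    assume \<beta>: "\<And>x. (\<beta> has_real_derivative \<beta>' x) (at x)" "continuous_on UNIV \<beta>'"
      "\<And>x. 1 \<le> \<bar>x - x0\<bar> \<Longrightarrow> \<beta> x = 0"
    have c\<beta>: "continuous_on UNIV \<beta>"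
      using \<beta>(1) by (meson DERIV_isCont continuous_at_imp_continuous_on)
    have \<beta>0: "\<beta> x = 0" if "b \<le> \<bar>x\<bar>" for x
      using that by (intro \<beta>(3)) (auto simp: b_def)
    define E where "E s = integral {-X..X} (\<lambda>x. mode_defect K ghat u_in u l s x * of_real (\<beta> x))" for s
    define \<alpha> where "\<alpha> s = cnj (E s) * of_real (max 0 (T - s))" for s
    \<comment> \<open>Normalized so that A vanishes from time T on, where its derivative is zero.\<close>
    define A where "A s = integral {0..s} \<alpha> - integral {0..T} \<alpha>" for s
    have "continuous_on ({0..} \<times> UNIV) (\<lambda>(s, x). mode_defect K ghat u_in u l s x * of_real (\<beta> x))"
      using cD unfolding case_prod_unfold
      by (intro continuous_intros continuous_on_compose2[OF c\<beta>]) auto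
    then have cE: "continuous_on {0..} E"
      unfolding E_def[abs_def] by (rule continuous_on_integral_space) auto
    then have c\<alpha>: "continuous_on {0..} \<alpha>"
      unfolding \<alpha>_def[abs_def] by (intro continuous_intros)
    have A: "(A has_vector_derivative \<alpha> s) (at s within {0..})" if "s \<ge> 0" for s
      unfolding A_def[abs_def] using has_vector_derivative_integral_upper_limit[OF c\<alpha> that]
      by (auto intro!: derivative_eq_intros)
    have A0: "A s = 0" if "s \<ge> T" for s
    proof -
      have "integral {0..T} \<alpha> + integral {T..s} \<alpha> = integral {0..s} \<alpha>"
        using T that continuous_on_subset[OF c\<alpha>, of "{0..s}"]
        by (intro Henstock_Kurzweil_Integration.integral_combine integrable_continuous_interval) auto
      moreover have "integral {T..s} \<alpha> = integral {T..s} (\<lambda>_. 0)"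
        by (rule Henstock_Kurzweil_Integration.integral_cong) (simp add: \<alpha>_def)
      ultimately show ?thesis by (simp add: A_def)
    qed
    define h where "h = (\<lambda>(t, l', \<xi>). if l' = l then A t * of_real (\<beta> (\<xi> + real l * t)) else 0)"
    note sep = separated_test_function[OF A c\<alpha> A0 \<beta>(1,2) \<beta>0 T b l, folded h_def]
    have "0 = weak_form K ghat u_in u h"
      using weak sep(1,2) by simp
    also have "\<dots> = (\<Sum>l'=1..l. integral {0..T+1} (\<lambda>s. integral {-X..X} (\<lambda>x.
        mode_defect K ghat u_in u l' s x *
        (partial_t h (s, l', x - real l' * s) - of_nat l' * partial_xi h (s, l', x - real l' * s)))))"
      by (rule test_function.weak_form_eq_sum_defects[OF sep(3) g a u]) (simp_all add: X_def)
    also have "\<dots> = (\<Sum>l'=1..l. if l' = l then integral {0..T+1} (\<lambda>s. \<alpha> s * E s) else 0)"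
    proof (rule sum.cong[OF refl])
      fix l' assume l': "l' \<in> {1..l}"
      have "integral {0..T+1} (\<lambda>s. integral {-X..X} (\<lambda>x. mode_defect K ghat u_in u l' s x *
          (partial_t h (s, l', x - real l' * s) - of_nat l' * partial_xi h (s, l', x - real l' * s)))) =
          integral {0..T+1} (\<lambda>s. if l' = l then \<alpha> s * E s else 0)"
        by (rule Henstock_Kurzweil_Integration.integral_cong)
          (use l' sep(4) in \<open>simp add: E_def mult.left_commute flip: integral_mult_right\<close>)
      then show "integral {0..T+1} (\<lambda>s. integral {-X..X} (\<lambda>x. mode_defect K ghat u_in u l' s x *
          (partial_t h (s, l', x - real l' * s) - of_nat l' * partial_xi h (s, l', x - real l' * s)))) =
          (if l' = l then integral {0..T+1} (\<lambda>s. \<alpha> s * E s) else 0)"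
        by simp
    qed
    also have "\<dots> = integral {0..T+1} (\<lambda>s. \<alpha> s * E s)"
      using l by simp
    finally have "0 = Re (integral {0..T+1} (\<lambda>s. \<alpha> s * E s))" by simp
    also have "\<dots> = integral {0..T+1} (\<lambda>s. Re (\<alpha> s * E s))"
      by (intro integral_Re[symmetric] continuous_intros continuous_on_subset[OF c\<alpha>]
          continuous_on_subset[OF cE]) auto
    also have "(\<lambda>s. Re (\<alpha> s * E s)) = (\<lambda>s. (cmod (E s))\<^sup>2 * max 0 (T - s))"
      unfolding \<alpha>_def cmod_power2 by (simp add: fun_eq_iff power2_eq_square algebra_simps)
    finally have "integral {0..T+1} (\<lambda>s. (cmod (E s))\<^sup>2 * max 0 (T - s)) = 0" by simp
    moreover have "continuous_on {0..T+1} (\<lambda>s. (cmod (E s))\<^sup>2 * max 0 (T - s))"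
      by (intro continuous_intros continuous_on_subset[OF cE]) auto
    ultimately have "\<forall>s\<in>{0..T+1}. (cmod (E s))\<^sup>2 * max 0 (T - s) = 0"
      using integral_eq_0_iff[of 0 "T + 1" "\<lambda>s. (cmod (E s))\<^sup>2 * max 0 (T - s)"] T by auto
    from bspec[OF this, of t] t have "E t = 0" by (simp add: T_def)
    then show "integral {-X..X} (\<lambda>x. mode_defect K ghat u_in u l t x * of_real (\<beta> x)) = 0"
      by (simp add: E_def)
  qed
qed

section \<open>Mild solutions and the evolution operator\<close>

text \<open>The explicit formulas of the theorem, with the trace of the solution itself in place of \<open>\<nu>\<close>.\<close>

definition mild_solution ::
  "real \<Rightarrow> (real \<Rightarrow> complex) \<Rightarrow> (nat \<times> real \<Rightarrow> complex) \<Rightarrow> (real \<times> nat \<times> real \<Rightarrow> complex) \<Rightarrow> bool"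
  where "mild_solution K ghat u_in u \<longleftrightarrow>
    (\<forall>t\<ge>0. \<forall>\<xi>. u (t, 1, \<xi>) = u_in (1, \<xi> + t) +
      integral {0..t} (\<lambda>s. of_real (K / 2) * u (s, 1, 0) * ghat (\<xi> + t - s))) \<and>
    (\<forall>t\<ge>0. \<forall>l\<ge>2. \<forall>\<xi>. u (t, l, \<xi>) = u_in (l, \<xi> + t * of_nat l))"

text \<open>The residual lives on the characteristic through \<open>(0, x)\<close>; the point \<open>(t, \<xi>)\<close> is on the one with
  \<open>x = \<xi> + l t\<close>.\<close>

lemma mild_solution_iff_defect:
  "mild_solution K ghat u_in u \<longleftrightarrow> (\<forall>l\<ge>1. \<forall>t\<ge>0. \<forall>x. mode_defect K ghat u_in u l t x = 0)"
proof -
  have shift: "(\<forall>x. mode_defect K ghat u_in u l t x = 0) \<longleftrightarrow>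
      (\<forall>\<xi>. mode_defect K ghat u_in u l t (\<xi> + real l * t) = 0)" for l t
    by (metis diff_add_cancel)
  have one: "mode_defect K ghat u_in u 1 t (\<xi> + real 1 * t) = 0 \<longleftrightarrow>
      u (t, 1, \<xi>) = u_in (1, \<xi> + t) +
        integral {0..t} (\<lambda>s. of_real (K / 2) * u (s, 1, 0) * ghat (\<xi> + t - s))" for t \<xi>
    by (simp add: mode_defect_def transport_defect_def mode_source_def diff_diff_eq)
  have high: "mode_defect K ghat u_in u l t (\<xi> + real l * t) = 0 \<longleftrightarrow>
      u (t, l, \<xi>) = u_in (l, \<xi> + t * of_nat l)" if "l \<ge> 2" for l t \<xi>
    using that by (simp add: mode_defect_def transport_defect_def mode_source_def mult.commute)
  have split: "(\<forall>l\<ge>1. P l) \<longleftrightarrow> P 1 \<and> (\<forall>l\<ge>2. P l)" for P :: "nat \<Rightarrow> bool"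
  proof -
    have "l \<ge> 1 \<longleftrightarrow> l = 1 \<or> l \<ge> 2" for l :: nat by linarith
    then show ?thesis by metis
  qed
  have "(\<forall>x. mode_defect K ghat u_in u 1 t x = 0) \<longleftrightarrow>
      (\<forall>\<xi>. u (t, 1, \<xi>) = u_in (1, \<xi> + t) +
        integral {0..t} (\<lambda>s. of_real (K / 2) * u (s, 1, 0) * ghat (\<xi> + t - s)))" for t
    by (subst shift) (simp only: one)
  moreover have "(\<forall>x. mode_defect K ghat u_in u l t x = 0) \<longleftrightarrow>
      (\<forall>\<xi>. u (t, l, \<xi>) = u_in (l, \<xi> + t * of_nat l))" if "l \<ge> 2" for l t
    by (subst shift) (simp only: high[OF that])
  ultimately show ?thesis
    unfolding mild_solution_def split by blast
qed

lemma weak_solution_iff_mild: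
  assumes g: "continuous_on UNIV ghat" and a: "continuous_on mode_dom u_in"
  shows "weak_solution K ghat u_in u \<longleftrightarrow>
    u \<in> extensional spacetime_dom \<and> continuous_on spacetime_dom u \<and> mild_solution K ghat u_in u"
proof -
  have "(\<forall>h. C1_spacetime h \<and> compactly_supported h \<longrightarrow> 0 = weak_form K ghat u_in u h) \<longleftrightarrow>
      mild_solution K ghat u_in u" if u: "continuous_on spacetime_dom u"
    unfolding mild_solution_iff_defect
    using weak_form_zero_of_mild[OF g a u] mild_of_weak_form_zero[OF g a u] by metis
  then show ?thesis
    unfolding weak_solution_def weak_form_def by blast
qed

lemma mild_solution_volterra:
  assumes "mild_solution K ghat u_in u" "t \<ge> 0"
  shows "u (t, 1, 0) = u_in (1, t) + volterra (\<lambda>s. of_real (K / 2) * ghat s) (\<lambda>s. u (s, 1, 0)) t"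
  using assms by (simp add: mild_solution_def volterra_def mult_ac)

text \<open>Solving the Volterra equation first gives the trace \<open>\<nu>\<close>, and the formulas then define the solution.
  Its trace is \<open>\<nu>\<close> again, precisely because of the Volterra equation, so the construction is
  consistent.\<close>

lemma mild_solution_exists:
  assumes g: "continuous_on UNIV ghat" and a: "continuous_on mode_dom u_in"
  obtains u where "u \<in> extensional spacetime_dom" "continuous_on spacetime_dom u"
    "mild_solution K ghat u_in u"
proof -
  define k where "k s = complex_of_real (K / 2) * ghat s" for s
  have k: "continuous_on UNIV k"
    unfolding k_def[abs_def] by (intro continuous_intros g)
  obtain \<nu> where \<nu>: "continuous_on {0..} \<nu>" "\<And>t. t \<ge> 0 \<Longrightarrow> \<nu> t = u_in (1, t) + volterra k \<nu> t"
    using volterra_exists[OF k continuous_on_initial_mode[OF a order_refl]] by blast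
  define v where "v = (\<lambda>(t, l, \<xi>). u_in (l, \<xi> + t * real l) +
    (if l = 1 then integral {0..t} (\<lambda>s. of_real (K / 2) * \<nu> s * ghat (\<xi> + t - s)) else 0))"
  define u where "u = restrict v spacetime_dom"
  have "continuous_on ({0..} \<times> UNIV) (\<lambda>(s, y). of_real (K / 2) * \<nu> s * ghat (y - s))"
    unfolding case_prod_unfold
    by (intro continuous_intros continuous_on_compose2[OF g] continuous_on_compose2[OF \<nu>(1)]) auto
  from continuous_on_integral_upper_limit_param[OF this]
  have "continuous_on ({0..} \<times> UNIV) (\<lambda>q. case (fst q, snd q + fst q) of (t, y) \<Rightarrow>
      integral {0..t} (\<lambda>s. of_real (K / 2) * \<nu> s * ghat (y - s)))"
    by (rule continuous_on_compose2) (auto intro!: continuous_intros)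
  then have "continuous_on ({0..} \<times> UNIV) (\<lambda>(t, \<xi>). v (t, l, \<xi>))" if "l \<ge> 1" for l
    unfolding v_def case_prod_unfold using that
    by (cases "l = 1")
      (auto intro!: continuous_intros continuous_on_compose2[OF continuous_on_initial_mode[OF a]])
  then have "continuous_on spacetime_dom v"
    by (rule continuous_on_spacetimeI)
  then have cu: "continuous_on spacetime_dom u"
    by (rule continuous_on_eq) (simp add: u_def)
  have u_eq: "u (t, l, \<xi>) = v (t, l, \<xi>)" if "t \<ge> 0" "l \<ge> 1" for t l \<xi>
    using that by (simp add: u_def spacetime_dom_def)
  have "u (t, 1, 0) = \<nu> t" if "t \<ge> 0" for t
    using \<nu>(2)[OF that] that by (simp add: u_eq v_def volterra_def k_def mult_ac)
  then have "mild_solution K ghat u_in u"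
    unfolding mild_solution_def
    by (auto simp: u_eq v_def intro!: Henstock_Kurzweil_Integration.integral_cong)
  with cu show ?thesis by (intro that[of u]) (simp_all add: u_def)
qed

text \<open>The traces agree as they solve the same Volterra equation, and the formulas express everything else
  through the trace and the initial data.\<close>

lemma mild_solution_unique:
  assumes g: "continuous_on UNIV ghat"
    and u: "u \<in> extensional spacetime_dom" "continuous_on spacetime_dom u" "mild_solution K ghat u_in u"
    and v: "v \<in> extensional spacetime_dom" "continuous_on spacetime_dom v" "mild_solution K ghat u_in v"
  shows "u = v"
proof (rule extensionalityI[OF u(1) v(1)])
  have k: "continuous_on UNIV (\<lambda>s. complex_of_real (K / 2) * ghat s)"
    by (intro continuous_intros g)
  have trace: "continuous_on {0..} (\<lambda>t. w (t, 1, 0))"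
    if "continuous_on spacetime_dom w" for w :: "real \<times> nat \<times> real \<Rightarrow> complex"
    by (rule continuous_on_space_slice[OF continuous_on_mode[OF that]]) auto
  have \<nu>: "u (t, 1, 0) = v (t, 1, 0)" if "t \<ge> 0" for t
    using volterra_unique[OF k trace[OF u(2)] trace[OF v(2)]
        mild_solution_volterra[OF u(3)] mild_solution_volterra[OF v(3)] that] by blast
  fix p assume "p \<in> spacetime_dom"
  then obtain t l \<xi> where p: "p = (t, l, \<xi>)" "t \<ge> 0" "l \<ge> 1"
    by (auto simp: spacetime_dom_def)
  show "u p = v p"
  proof (cases "l = 1")
    case True
    have "integral {0..t} (\<lambda>s. of_real (K / 2) * u (s, 1, 0) * ghat (\<xi> + t - s)) =
        integral {0..t} (\<lambda>s. of_real (K / 2) * v (s, 1, 0) * ghat (\<xi> + t - s))"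
      by (rule Henstock_Kurzweil_Integration.integral_cong) (simp add: \<nu>[simplified])
    with True u(3) v(3) p show ?thesis unfolding mild_solution_def by simp
  next
    case False
    with u(3) v(3) p show ?thesis unfolding mild_solution_def by simp
  qed
qed

theorem lemma2:
  fixes K :: real and ghat :: "real \<Rightarrow> complex" and u_in :: "nat \<times> real \<Rightarrow> complex"
  assumes "K \<ge> 0"
    and "continuous_on UNIV ghat"
    and "continuous_on mode_dom u_in"
  shows "(\<exists>!u. weak_solution K ghat u_in u) \<and>
    weak_solution K ghat u_in (\<lambda>(t, l, \<xi>). evolution K ghat t u_in (l, \<xi>)) \<and>
    (let \<nu> = (\<lambda>t. evolution K ghat t u_in (1, 0));
         k = (\<lambda>t. - complex_of_real (K / 2) * ghat t)
     in (\<forall>t\<ge>0. \<nu> t + convolution k \<nu> t = u_in (1, t)) \<and>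
        (\<forall>t\<ge>0. \<forall>\<xi>. evolution K ghat t u_in (1, \<xi>) =
           u_in (1, \<xi> + t)
           + (LBINT s:{0..t}. complex_of_real (K / 2) * \<nu> s * ghat (\<xi> + t - s))) \<and>
        (\<forall>t\<ge>0. \<forall>l\<ge>2. \<forall>\<xi>. evolution K ghat t u_in (l, \<xi>) = u_in (l, \<xi> + t * of_nat l)))"
proof -
  note g = assms(2) and a = assms(3)
  note iff = weak_solution_iff_mild[OF g a, of K]
  obtain u where u: "weak_solution K ghat u_in u"
    using mild_solution_exists[OF g a, of K] iff by metis
  have unique: "v = u" if "weak_solution K ghat u_in v" for v
    using that u mild_solution_unique[OF g] unfolding iff by blast
  then have the: "(THE u. weak_solution K ghat u_in u) = u"
    using u by (intro the_equality)
  have ev: "evolution K ghat t u_in (l, \<xi>) = u (t, l, \<xi>)" for t l \<xi>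
    by (simp add: evolution_def the)
  have cu: "continuous_on spacetime_dom u" and mild: "mild_solution K ghat u_in u"
    using u unfolding iff by auto
  have trace: "continuous_on {0..t} (\<lambda>s. u (s, 1, 0))" for t
    by (rule continuous_on_space_slice[OF continuous_on_mode[OF cu]]) auto
  have LBINT: "(LBINT s:{0..t}. complex_of_real (K / 2) * u (s, 1, 0) * ghat (\<xi> + t - s)) =
      integral {0..t} (\<lambda>s. of_real (K / 2) * u (s, 1, 0) * ghat (\<xi> + t - s))" for t \<xi>
    by (intro set_LBINT_eq_integral continuous_intros trace continuous_on_compose2[OF g]) auto
  have mode1: "u (t, 1, \<xi>) = u_in (1, \<xi> + t) +
      (LBINT s:{0..t}. complex_of_real (K / 2) * u (s, 1, 0) * ghat (\<xi> + t - s))" if "t \<ge> 0" for t \<xi>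
    using mild that unfolding LBINT mild_solution_def by blast
  \<comment> \<open>At frequency zero the integral in the first-mode formula is minus the convolution with k.\<close>
  have "convolution (\<lambda>t. - complex_of_real (K / 2) * ghat t) (\<lambda>t. u (t, 1, 0)) t =
      - (LBINT s:{0..t}. complex_of_real (K / 2) * u (s, 1, 0) * ghat (0 + t - s))" for t
    unfolding convolution_def set_lebesgue_integral_def
    by (simp add: mult_ac flip: Bochner_Integration.integral_minus)
  then have volterra: "u (t, 1, 0) +
      convolution (\<lambda>t. - complex_of_real (K / 2) * ghat t) (\<lambda>t. u (t, 1, 0)) t = u_in (1, t)"
    if "t \<ge> 0" for t
    using mode1[OF that, of 0] by simp
  show ?thesis
    unfolding Let_def ev
  proof (intro conjI allI impI)
    show "\<exists>!u. weak_solution K ghat u_in u" using u unique by blast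
    show "weak_solution K ghat u_in (\<lambda>(t, l, \<xi>). u (t, l, \<xi>))" using u by simp
    show "u (t, l, \<xi>) = u_in (l, \<xi> + t * of_nat l)" if "t \<ge> 0" "l \<ge> 2" for t l \<xi>
      using mild that unfolding mild_solution_def by blast
  qed (use volterra mode1 in blast)+
qed

end
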